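(* Let $n_1\le n_2$, let $\Phi:\mathbb{R}^{n_1\times n_2}\to\mathbb{R}^m$ be a linear operator, $\mu>0$, and let $h:\mathbb{R}^m\to\mathbb{R}\cup\{+\infty\}$ be proper convex, twice continuously differentiable in $\operatorname{int}(\operatorname{dom} h)$, with $\nabla^2h(\Phi X)$ positive definite for every $X\in\Phi^{-1}(\operatorname{int}(\operatorname{dom} h))$. Consider the problem $$\min_{X\in\mathbb{R}^{n_1\times n_2}}\ h(\Phi X)+\mu\|X\|_* .$$ Suppose that $\bar X\in\Phi^{-1}(\operatorname{int}(\operatorname{dom} h))$ is a minimizer of this problem, and let $\bar Y:=-\frac1\mu\Phi^*\nabla h(\Phi\bar X)\in\partial\|\bar X\|_*$, $r=\operatorname{rank}(\bar X)$, and $(\bar U,\bar V)\in\mathcal{O}(\bar X)\cap\mathcal{O}(\bar Y)$. Then $$T_{N_{\mathbb{B}}(\bar Y)}(\bar X)=\left\{\bar U\begin{pmatrix}A & B & 0\\ B^T & C & 0\\ 0 & 0 & 0\end{pmatrix}\bar V^T\ \Big|\ A\in\mathbb{S}^r,\ B\in\mathbb{R}^{r\times(p(\bar Y)-r)},\ C\in\mathbb{S}_+^{p(\bar Y)-r}\right\}.$$ Hence $\bar X$ is a strong solution of the problem if and only if $$\operatorname{Ker}\Phi\cap T_{N_{\mathbb{B}}(\bar Y)}(\bar X)=\{0\}.$$ Consequently, $\bar X$ is a strong solution of the problem provided that $$\operatorname{Ker}\Phi\cap\bar U\begin{pmatrix}\mathbb{S}^{p(\bar Y)} & 0\\ 0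 & 0\end{pmatrix}\bar V^T=\{0\}.$$
   Context: $\mathbb{R}^{n_1\times n_2}$ carries the inner product $\langle X,Y\rangle=\operatorname{Tr}(X^TY)$ with Frobenius norm $\|\cdot\|_F$; $\|\cdot\|_*$ is the nuclear norm, $\|\cdot\|$ the spectral norm, and $\sigma_1(X)\ge\dots\ge\sigma_{n_1}(X)$ the singular values. $\mathbb{B}=\{Z\mid\|Z\|\le1\}$, and $N_{\mathbb{B}}(\bar Y)=\{X\mid\langle X,Z-\bar Y\rangle\le0\ \forall Z\in\mathbb{B}\}$. $\mathcal{O}(X)$ is the set of pairs $(U,V)$ of orthogonal matrices ($n_1\times n_1$ and $n_2\times n_2$) such that $X=U\,\mathrm{Diag}(\sigma(X))\,V^T$, where $\mathrm{Diag}(\sigma(X))$ is the $n_1\times n_2$ matrix with $\sigma_1(X)\ge\dots\ge\sigma_{n_1}(X)$ on the diagonal and zeros elsewhere (for $\bar Y\in\partial\|\bar X\|_*$ the set $\mathcal{O}(\bar X)\cap\mathcal{O}(\bar Y)$ is nonempty). $p(\bar Y)=\#\{i\mid\sigma_i(\bar Y)=1\}$. $\mathbb{S}^k$ and $\mathbb{S}^k_+$ are the symmetric and symmetric positive semidefinite $k\times k$ matrices. The contingent cone to a closed set $K$ at $\bar X\in K$ is $T_K(\bar X)=\{W\mid\exists\, t_k\downarrow0,\ W_k\to W,\ \bar X+t_kW_k\in K\}$. $\bar X$ is a strong solution of $\min\varphi$ if there exist $c,\varepsilon>0$ with $\varphi(X)-\varphi(\bar X)\ge c\|X-\bar X\|_F^2$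 for all $X$ with $\|X-\bar X\|_F\le\varepsilon$. *)

theory Defs
  imports "HOL-Analysis.Analysis" "HOL-Library.Multiset"
begin

text \<open>
  An \<open>n\<^sub>1 \<times> n\<^sub>2\<close> matrix has type \<open>real^'n2^'n1\<close>. The library's inner product and norm on
  this type are the trace inner product and the Frobenius norm:
\<close>

lemma inner_matrix_eq_trace:
  fixes X Y :: "real^'n^'m"
  shows "X \<bullet> Y = trace (transpose X ** Y)"
  unfolding trace_def matrix_matrix_mult_def transpose_def inner_vec_def
  by simp (rule sum.swap)

text \<open>
  The index types are finite linear orders, so that rows and columns have positions. All positions
  are counted from \<open>0\<close>: \<open>pos i\<close> is the number of indices strictly below \<open>i\<close>.
\<close>

definition pos :: "'n::{finite,linorder} \<Rightarrow> nat" where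
  "pos i = card {j. j < i}"


section \<open>Singular values\<close>

definition eigenspace :: "real^'n^'n \<Rightarrow> real \<Rightarrow> (real^'n) set" where
  "eigenspace M l = {v. M *v v = l *\<^sub>R v}"

text \<open>
  The singular values of \<open>X\<close> are the square roots of the eigenvalues of \<open>X X\<^sup>T\<close>, repeated according
  to multiplicity (algebraic and geometric multiplicity agree, as \<open>X X\<^sup>T\<close> is symmetric) and listed in
  nonincreasing order. Hence \<open>sing_val X k\<close> is \<open>\<sigma>\<^sub>k\<^sub>+\<^sub>1(X)\<close>; it is only used for \<open>k\<close> below the number
  of rows of \<open>X\<close>.
\<close>

definition sing_val :: "real^'n^'m \<Rightarrow> nat \<Rightarrow> real" where
  "sing_val X k =
     rev (sorted_list_of_multiset
       (\<Sum>l \<in> {l. \<exists>v\<in>eigenspace (X ** transpose X) l. v \<noteq> 0}.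
          replicate_mset (dim (eigenspace (X ** transpose X) l)) (sqrt l))) ! k"

definition nuclear_norm :: "real^'n^'m \<Rightarrow> real" where
  "nuclear_norm (X :: real^'n^'m) = (\<Sum>k<CARD('m). sing_val X k)"

definition spectral_norm :: "real^'n^'m \<Rightarrow> real" where
  "spectral_norm X = onorm (\<lambda>v. X *v v)"

definition spectral_ball :: "(real^'n^'m) set" where
  "spectral_ball = {Z. spectral_norm Z \<le> 1}"

definition rect_diag :: "(nat \<Rightarrow> real) \<Rightarrow> real^('n::{finite,linorder})^('m::{finite,linorder})" where
  "rect_diag s = (\<chi> i j. if pos i = pos j then s (pos i) else 0)"

definition svd_pairs ::
  "real^('n::{finite,linorder})^('m::{finite,linorder}) \<Rightarrow>
     ((real^('m::{finite,linorder})^('m::{finite,linorder})) \<times>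
      (real^('n::{finite,linorder})^('n::{finite,linorder}))) set" where
  "svd_pairs X = {(U, V). orthogonal_matrix U \<and> orthogonal_matrix V \<and>
                          X = U ** rect_diag (sing_val X) ** transpose V}"

definition num_unit_sing_vals :: "real^'n^'m \<Rightarrow> nat" where
  "num_unit_sing_vals (Y :: real^'n^'m) = card {k. k < CARD('m) \<and> sing_val Y k = 1}"


section \<open>Blocks of variable size\<close>

text \<open>
  Blocks whose size depends on \<open>r\<close> and \<open>p\<close> are functions \<open>nat \<Rightarrow> nat \<Rightarrow> real\<close>, of which only the
  entries within the stated size matter.
\<close>

definition sym_block :: "nat \<Rightarrow> (nat \<Rightarrow> nat \<Rightarrow> real) \<Rightarrow> bool" where
  "sym_block k A \<longleftrightarrow> (\<forall>i<k. \<forall>j<k. A i j = A j i)"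

definition psd_block :: "nat \<Rightarrow> (nat \<Rightarrow> nat \<Rightarrow> real) \<Rightarrow> bool" where
  "psd_block k A \<longleftrightarrow> sym_block k A \<and> (\<forall>x. 0 \<le> (\<Sum>i<k. \<Sum>j<k. x i * A i j * x j))"

text \<open>The matrix \<open>(A B; D C)\<close>, where \<open>A\<close> has size \<open>r \<times> r\<close>.\<close>

definition four_block ::
  "nat \<Rightarrow> (nat \<Rightarrow> nat \<Rightarrow> real) \<Rightarrow> (nat \<Rightarrow> nat \<Rightarrow> real) \<Rightarrow> (nat \<Rightarrow> nat \<Rightarrow> real) \<Rightarrow> (nat \<Rightarrow> nat \<Rightarrow> real)
     \<Rightarrow> nat \<Rightarrow> nat \<Rightarrow> real" where
  "four_block r A B D C i j =
     (if i < r then (if j < r then A i j else B i (j - r))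
      else (if j < r then D (i - r) j else C (i - r) (j - r)))"

text \<open>The rectangular matrix \<open>(M 0; 0 0)\<close>, where \<open>M\<close> has size \<open>p \<times> p\<close>.\<close>

definition corner ::
  "nat \<Rightarrow> (nat \<Rightarrow> nat \<Rightarrow> real) \<Rightarrow> real^('n::{finite,linorder})^('m::{finite,linorder})" where
  "corner p M = (\<chi> i j. if pos i < p \<and> pos j < p then M (pos i) (pos j) else 0)"


section \<open>Variational analysis\<close>

definition normal_cone :: "'a::real_inner set \<Rightarrow> 'a \<Rightarrow> 'a set" where
  "normal_cone C y = {x. \<forall>z\<in>C. x \<bullet> (z - y) \<le> 0}"

definition contingent_cone :: "'a::real_normed_vector set \<Rightarrow> 'a \<Rightarrow> 'a set" where
  "contingent_cone K x =
     {w. \<exists>(t :: nat \<Rightarrow> real) W. (\<forall>k. t k > 0) \<and> t \<longlonglongrightarrow> 0 \<and> W \<longlonglongrightarrow> w \<and>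
           (\<forall>k. x + t k *\<^sub>R W k \<in> K)}"

definition subdifferential :: "('a::real_inner \<Rightarrow> real) \<Rightarrow> 'a \<Rightarrow> 'a set" where
  "subdifferential f x = {g. \<forall>z. f z \<ge> f x + g \<bullet> (z - x)}"

text \<open>
  The value at the solution has to be finite for the difference to make sense (for \<open>ereal\<close>,
  \<open>\<infinity> - \<infinity> = \<infinity>\<close>).
\<close>

definition strong_solution :: "('a::real_normed_vector \<Rightarrow> ereal) \<Rightarrow> 'a \<Rightarrow> bool" where
  "strong_solution \<phi> x \<longleftrightarrow> \<bar>\<phi> x\<bar> \<noteq> \<infinity> \<and>
     (\<exists>c>0. \<exists>\<epsilon>>0. \<forall>z. norm (z - x) \<le> \<epsilon> \<longrightarrow> \<phi> z - \<phi> x \<ge> ereal (c * (norm (z - x))\<^sup>2))"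

definition edom :: "('a \<Rightarrow> ereal) \<Rightarrow> 'a set" where
  "edom h = {x. h x < \<infinity>}"

definition proper_convex :: "('a::real_vector \<Rightarrow> ereal) \<Rightarrow> bool" where
  "proper_convex h \<longleftrightarrow> (\<forall>x. h x \<noteq> -\<infinity>) \<and> edom h \<noteq> {} \<and>
     (\<forall>x y t. 0 \<le> t \<and> t \<le> 1 \<longrightarrow>
        h ((1 - t) *\<^sub>R x + t *\<^sub>R y) \<le> ereal (1 - t) * h x + ereal t * h y)"

definition gradient :: "(real^'m \<Rightarrow> real) \<Rightarrow> real^'m \<Rightarrow> real^'m" where
  "gradient f x = (THE D. GDERIV f x :> D)"

definition hessian :: "(real^'m \<Rightarrow> real) \<Rightarrow> real^'m \<Rightarrow> real^'m^'m" where
  "hessian f x = matrix (frechet_derivative (gradient f) (at x))"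

text \<open>
  Intended for open \<open>S\<close>; continuity of \<open>f\<close> and of its gradient follows from differentiability.
\<close>

definition C2_on :: "(real^'m) set \<Rightarrow> (real^'m \<Rightarrow> real) \<Rightarrow> bool" where
  "C2_on S f \<longleftrightarrow> (\<forall>x\<in>S. f differentiable (at x)) \<and>
     (\<forall>x\<in>S. gradient f differentiable (at x)) \<and> continuous_on S (hessian f)"

definition positive_definite :: "real^'m^'m \<Rightarrow> bool" where
  "positive_definite A \<longleftrightarrow> transpose A = A \<and> (\<forall>v. v \<noteq> 0 \<longrightarrow> v \<bullet> (A *v v) > 0)"

definition Ker :: "('a \<Rightarrow> 'b::zero) \<Rightarrow> 'a set" where
  "Ker \<Phi> = {x. \<Phi> x = 0}"

definition nuclear_objective ::
  "(real^'m \<Rightarrow> ereal) \<Rightarrow> (real^'n2^'n1 \<Rightarrow> real^'m) \<Rightarrow> real \<Rightarrow> real^'n2^'n1 \<Rightarrow> ereal" where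
  "nuclear_objective h \<Phi> \<mu> X = h (\<Phi> X) + ereal (\<mu> * nuclear_norm X)"

end

theory Submission
  imports Defs
begin

text \<open>
  The nuclear norm is the support function of the spectral ball, so its gap
  \<open>\<parallel>Z\<parallel>\<^sub>* - \<langle>Y, Z\<rangle>\<close> is nonnegative and vanishes exactly on \<open>N\<^sub>B(Y)\<close>. Expanding \<open>Z\<close> along its
  singular vectors, one sees that the gap dominates a multiple of
  \<open>dist(Z, N\<^sub>B(Y))\<^sup>2\<close>: the singular values of \<open>Y\<close> other than \<open>1\<close> stay away from \<open>1\<close>, so a small gap
  forces the left singular vectors of \<open>Z\<close> into the first \<open>p\<close> coordinates (in the basis \<open>U\<close>) and the
  right ones to agree with them, which makes \<open>Z\<close> nearly \<open>U (S 0; 0 0) V\<^sup>T\<close> with \<open>S\<close> positive semidefinite.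

  Up to its linear part, which cancels against \<open>Y\<close>, the objective is the sum of
  \<open>h\<close>'s second-order remainder at \<open>\<Phi> X\<close> and of \<open>\<mu>\<close> times the gap. If \<open>X\<close> is not a strong solution,
  a normalised sequence violating quadratic growth has a limit direction on which the Hessian
  vanishes, hence in \<open>Ker \<Phi>\<close>, while the gap is of order \<open>o(t\<^sup>2)\<close>, hence the direction is tangent to
  \<open>N\<^sub>B(Y)\<close>. Conversely the objective grows by \<open>o(t\<^sup>2)\<close> along any tangent direction in \<open>Ker \<Phi>\<close>.
\<close>

section \<open>Orthonormal eigenbases\<close>

text \<open>The estimate against the gap does double duty: at a point of zero gap it also shows that
  N_B(Y) contains nothing beyond the image of the semidefinite corner. Its factor is not uniform but
  a multiple of the nuclear norm of Z, which comes from a Cauchy-Schwarz step weighted by the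
  singular values; continuity of the nuclear norm makes this harmless near X. The pair (U, V) is one
  simultaneous decomposition of X and Y. Undoing it makes both diagonal, and E = (I 0), with E E^T =
  I because n1 \<le> n2, reduces rectangular matrices to square ones. Tangents are computed for the
  square semidefinite corner and carried back by the injective map S -> U S E V^T. The obstacle
  there is that Sigma + t W need not be semidefinite for a listed block matrix W: B couples the
  positive block with a possibly singular C, so a straight line does not do and a curve with
  higher-order corrections is used. That Y is a subgradient is derived from minimality: a remainder
  of order t^2 disappears after division by t.\<close>

lemma self_adjoint_eigenvector:
  fixes f :: "'a::euclidean_space \<Rightarrow> 'a"
  assumes lin: "linear f" and sa: "\<And>x y. f x \<bullet> y = x \<bullet> f y"
    and S: "subspace S" "f ` S \<subseteq> S" "S \<noteq> {0}"
  obtains v c where "v \<in> S" "norm v = 1" "f v = c *\<^sub>R v"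
proof -
  let ?q = "\<lambda>x. x \<bullet> f x"
  obtain x0 where x0: "x0 \<in> S" "x0 \<noteq> 0" using S subspace_0 by blast
  have "compact (S \<inter> sphere 0 1)"
    using closed_subspace[OF S(1)] by (simp add: closed_Int_compact)
  moreover have "x0 /\<^sub>R norm x0 \<in> S \<inter> sphere 0 1"
    using x0 S(1) by (simp add: subspace_scale)
  moreover have "continuous_on (S \<inter> sphere 0 1) ?q"
    by (intro continuous_intros linear_continuous_on linear_conv_bounded_linear[THEN iffD1] lin)
  ultimately obtain v where v: "v \<in> S" "norm v = 1"
    and max: "\<And>y. y \<in> S \<Longrightarrow> norm y = 1 \<Longrightarrow> ?q y \<le> ?q v"
    using continuous_attains_sup[of "S \<inter> sphere 0 1" ?q] by force
  define c where "c = ?q v"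
  have ub: "?q x \<le> c * (norm x)\<^sup>2" if "x \<in> S" for x
  proof (cases "x = 0")
    case False
    have "?q (x /\<^sub>R norm x) \<le> c"
      unfolding c_def using that False S(1) by (intro max) (auto simp: subspace_scale)
    also have "?q (x /\<^sub>R norm x) = ?q x / (norm x)\<^sup>2"
      by (simp add: linear_cmul[OF lin] power2_eq_square divide_inverse)
    finally show ?thesis using False by (simp add: divide_le_eq)
  qed (simp add: linear_0[OF lin])
  define w where "w = f v - c *\<^sub>R v"
  have wS: "w \<in> S" using v(1) S unfolding w_def by (intro subspace_diff subspace_scale) auto
  have wv: "w \<bullet> v = 0"
    using v(2) by (simp add: w_def c_def inner_diff inner_commute norm_eq_1)
  have wf: "w \<bullet> f v = (norm w)\<^sup>2"
    using wv by (simp add: w_def inner_diff power2_norm_eq_inner algebra_simps inner_commute)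
  define a b where "a = (norm w)\<^sup>2" and "b = c * a - ?q w"
  \<comment> \<open>First-order optimality of the maximiser \<open>v\<close>: its residual
    \<open>w\<close> is orthogonal to \<open>v\<close>, so moving along \<open>w\<close> changes the
    squared norm only at order t^2 but the quadratic form already at order t, with coefficient
    \<open>2 * a\<close>.\<close>
  have key: "2 * t * a \<le> t\<^sup>2 * b" for t
  proof -
    have "?q (v + t *\<^sub>R w) \<le> c * (norm (v + t *\<^sub>R w))\<^sup>2"
      using v(1) wS S(1) by (intro ub subspace_add subspace_scale)
    moreover have "?q (v + t *\<^sub>R w) = c + 2 * t * a + t\<^sup>2 * ?q w"
      using sa[of w v] wf
      by (simp add: a_def c_def linear_add[OF lin] linear_cmul[OF lin] inner_add
          inner_commute power2_eq_square algebra_simps)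
    moreover have "(norm (v + t *\<^sub>R w))\<^sup>2 = 1 + t\<^sup>2 * a"
      using v(2) wv unfolding power2_norm_eq_inner a_def
      by (simp add: inner_add inner_commute power2_eq_square norm_eq_1)
    ultimately show ?thesis by (simp add: b_def algebra_simps)
  qed
  have "a = 0"
  proof (rule ccontr)
    assume "a \<noteq> 0"
    then have a: "a > 0" by (simp add: a_def)
    \<comment> \<open>Small enough that \<open>t * \<bar>b\<bar> \<le> a\<close>, against the
      \<open>2 * a\<close> that \<open>key\<close> demands.\<close>
    define t where "t = a / (\<bar>b\<bar> + 1)"
    have t: "t > 0" using a by (simp add: t_def)
    then have "2 * a \<le> t * b" using key[of t] by (simp add: power2_eq_square)
    also have "t * b \<le> t * \<bar>b\<bar>" using t by (simp add: mult_left_mono)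
    also have "\<dots> \<le> a" using a by (simp add: t_def field_simps)
    finally show False using a by simp
  qed
  then have "f v = c *\<^sub>R v" by (simp add: a_def w_def)
  with v that show ?thesis by blast
qed

text \<open>Induction on the dimension: split off a unit eigenvector; its orthogonal complement
  within \<open>S\<close> is again invariant because \<open>f\<close> is self-adjoint.\<close>

lemma self_adjoint_eigenbasis_subspace:
  fixes f :: "'a::euclidean_space \<Rightarrow> 'a"
  assumes lin: "linear f" and sa: "\<And>x y. f x \<bullet> y = x \<bullet> f y"
    and S: "subspace S" "f ` S \<subseteq> S"
  shows "\<exists>B. finite B \<and> B \<subseteq> S \<and> pairwise orthogonal B \<and> S \<subseteq> span B \<and>
           (\<forall>b\<in>B. norm b = 1 \<and> (\<exists>c. f b = c *\<^sub>R b))"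
  using S
proof (induction "dim S" arbitrary: S rule: less_induct)
  case less
  show ?case
  proof (cases "S = {0}")
    case True
    then show ?thesis by (intro exI[of _ "{}"]) auto
  next
    case False
    then obtain v c where v: "v \<in> S" "norm v = 1" "f v = c *\<^sub>R v"
      using self_adjoint_eigenvector[OF lin sa] less.prems by metis
    define S' where "S' = S \<inter> {x. v \<bullet> x = 0}"
    have sub: "subspace S'"
      unfolding S'_def by (intro subspace_inter less.prems(1) subspace_hyperplane)
    have inv: "f ` S' \<subseteq> S'"
    proof -
      have "v \<bullet> f x = 0" if "v \<bullet> x = 0" for x
        using that v(3) sa[of v x] by simp
      then show ?thesis using less.prems(2) by (auto simp: S'_def)
    qed
    have "v \<notin> S'" using v(2) by (auto simp: S'_def norm_eq_1)
    moreover have "S' \<subseteq> S" by (simp add: S'_def)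
    ultimately have "S' \<subset> S" using v(1) by blast
    then have "dim S' < dim S"
      using sub less.prems(1) by (intro dim_psubset) (simp only: span_eq_iff[THEN iffD2])
    from less.hyps[OF this sub inv] obtain B where B: "finite B" "B \<subseteq> S'" "pairwise orthogonal B"
      "S' \<subseteq> span B" "\<forall>b\<in>B. norm b = 1 \<and> (\<exists>c. f b = c *\<^sub>R b)" by blast
    have "x \<in> span (insert v B)" if "x \<in> S" for x
    proof -
      have "x - (v \<bullet> x) *\<^sub>R v \<in> S'"
        using that v less.prems(1)
        by (auto simp: S'_def inner_diff norm_eq_1 intro: subspace_diff subspace_scale)
      then show ?thesis using B(4) by (auto simp: span_insert)
    qed
    then show ?thesis
      using B v by (intro exI[of _ "insert v B"])
        (auto simp: S'_def pairwise_insert orthogonal_def inner_commute)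
  qed
qed

definition orthonormal_family :: "('i \<Rightarrow> 'a::real_inner) \<Rightarrow> bool" where
  "orthonormal_family u \<longleftrightarrow> (\<forall>i j. u i \<bullet> u j = (if i = j then 1 else 0))"

lemma orthonormal_familyD:
  assumes "orthonormal_family u"
  shows "u i \<bullet> u j = (if i = j then 1 else 0)" "norm (u i) = 1"
  using assms by (auto simp: orthonormal_family_def norm_eq_1)

definition eigenbasis :: "real^'n^'n \<Rightarrow> ('n \<Rightarrow> real^'n) \<Rightarrow> ('n \<Rightarrow> real) \<Rightarrow> bool" where
  "eigenbasis M u l \<longleftrightarrow> orthonormal_family u \<and> (\<forall>i. M *v u i = l i *\<^sub>R u i)"

text \<open>The spectral theorem, with the basis indexed by the coordinate type itself, so that the
  basis vectors can be read as the rows of an orthogonal matrix.\<close>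

lemma symmetric_matrix_eigenbasis:
  fixes M :: "real^'n^'n"
  assumes "transpose M = M"
  shows "\<exists>u l. eigenbasis M u l"
proof -
  have sa: "(M *v x) \<bullet> y = x \<bullet> (M *v y)" for x y
    by (metis assms dot_lmul_matrix vector_transpose_matrix)
  obtain B where B: "finite B" "pairwise orthogonal B" "UNIV \<subseteq> span B"
    "\<forall>b\<in>B. norm b = 1 \<and> (\<exists>c. M *v b = c *\<^sub>R b)"
    using self_adjoint_eigenbasis_subspace[OF matrix_vector_mul_linear sa subspace_UNIV] by auto
  have "0 \<notin> B" using B(4) by force
  then have "independent B" using B(2) pairwise_orthogonal_independent by blast
  then have "card B = CARD('n)" using B(3)
    by (metis dim_UNIV DIM_cart DIM_real mult.right_neutral basis_card_eq_dim subset_UNIV)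
  then obtain u where u: "bij_betw u (UNIV :: 'n set) B"
    using finite_same_card_bij[OF finite B(1)] by metis
  then have uB: "u i \<in> B" for i by (auto simp: bij_betw_def)
  then have "\<forall>i. \<exists>c. M *v u i = c *\<^sub>R u i" using B(4) by blast
  from choice[OF this] obtain l where l: "\<forall>i. M *v u i = l i *\<^sub>R u i" ..
  have "u i \<bullet> u j = (if i = j then 1 else 0)" for i j
  proof (cases "i = j")
    case True
    then show ?thesis using B(4) uB by (simp add: norm_eq_1[symmetric])
  next
    case False
    then have "u i \<noteq> u j" using u by (auto simp: bij_betw_def inj_on_def)
    then show ?thesis using B(2) uB False by (auto simp: pairwise_def orthogonal_def)
  qed
  then have "orthonormal_family u" by (simp add: orthonormal_family_def)
  then show ?thesis using l unfolding eigenbasis_def by blast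
qed

lemma orthonormal_family_matrix:
  fixes u :: "'n \<Rightarrow> real^'n"
  assumes "orthonormal_family u"
  shows "orthogonal_matrix (\<chi> i. u i)"
  using assms
  by (simp add: orthogonal_matrix_orthonormal_rows row_def orthonormal_family_def orthogonal_def norm_eq_1)

lemma parseval:
  fixes u :: "'n \<Rightarrow> real^'n"
  assumes "orthonormal_family u"
  shows "x \<bullet> y = (\<Sum>i\<in>UNIV. (u i \<bullet> x) * (u i \<bullet> y))"
proof -
  let ?Q = "\<chi> i. u i"
  have "(?Q *v x) \<bullet> (?Q *v y) = x \<bullet> y"
    using orthogonal_transformation_matrix orthonormal_family_matrix[OF assms]
    by (metis matrix_of_matrix_vector_mul orthogonal_transformation_def matrix_vector_mul_linear)
  moreover have "(?Q *v x) $ i = u i \<bullet> x" for x i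
    by (simp add: matrix_vector_mult_def inner_vec_def)
  ultimately show ?thesis by (simp add: inner_vec_def[of "?Q *v x"])
qed

lemma parseval_norm:
  fixes u :: "'n \<Rightarrow> real^'n"
  assumes "orthonormal_family u"
  shows "(norm x)\<^sup>2 = (\<Sum>i\<in>UNIV. (u i \<bullet> x)\<^sup>2)"
  using parseval[OF assms, of x x] unfolding power2_norm_eq_inner by (simp add: power2_eq_square)

lemma orthonormal_expansion:
  fixes u :: "'n \<Rightarrow> real^'n"
  assumes "orthonormal_family u"
  shows "x = (\<Sum>i\<in>UNIV. (u i \<bullet> x) *\<^sub>R u i)"
proof -
  have "x \<bullet> y = (\<Sum>i\<in>UNIV. (u i \<bullet> x) *\<^sub>R u i) \<bullet> y" for y
    by (simp add: inner_sum_left parseval[OF assms, of x y])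
  then show ?thesis by (metis vector_eq_rdot)
qed

lemma transpose_vector_inner:
  fixes A :: "real^'n^'m"
  shows "(transpose A *v x) \<bullet> y = x \<bullet> (A *v y)"
  by (metis dot_lmul_matrix vector_transpose_matrix transpose_transpose)

text \<open>Parseval applied column by column. With left singular vectors as the basis, it turns
  matrix inner products into sums weighted by singular values.\<close>

lemma inner_matrix_orthonormal:
  fixes A B :: "real^'n^'m" and u :: "'m \<Rightarrow> real^'m"
  assumes "orthonormal_family u"
  shows "A \<bullet> B = (\<Sum>i\<in>UNIV. (transpose A *v u i) \<bullet> (transpose B *v u i))"
proof -
  have t: "(transpose A *v w) $ j = w \<bullet> column j A" for A :: "real^'n^'m" and w j
    by (simp add: matrix_vector_mult_def transpose_def inner_vec_def column_def mult.commute)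
  have "A \<bullet> B = (\<Sum>j\<in>UNIV. column j A \<bullet> column j B)"
    unfolding inner_vec_def column_def by simp (rule sum.swap)
  also have "\<dots> = (\<Sum>j\<in>UNIV. \<Sum>i\<in>UNIV. (u i \<bullet> column j A) * (u i \<bullet> column j B))"
    by (intro sum.cong refl parseval[OF assms])
  also have "\<dots> = (\<Sum>i\<in>UNIV. (transpose A *v u i) \<bullet> (transpose B *v u i))"
    unfolding inner_vec_def[of "transpose A *v _"] t inner_real_def by (rule sum.swap)
  finally show ?thesis .
qed

section \<open>Singular values and duality with the spectral norm\<close>

text \<open>Links the multiplicities in the definition of \<open>sing_val\<close>, which are
  dimensions of eigenspaces, to counting indices of an eigenbasis. The coefficient of an eigenvector
  along \<open>u j\<close> must vanish unless \<open>l j\<close> is its eigenvalue.\<close>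

lemma eigenspace_orthonormal_family:
  fixes M :: "real^'n^'n" and u :: "'n \<Rightarrow> real^'n"
  assumes u: "orthonormal_family u" and M: "\<And>i. M *v u i = l i *\<^sub>R u i"
  shows "eigenspace M c = span (u ` {i. l i = c})" "dim (eigenspace M c) = card {i. l i = c}"
proof -
  note ou = orthonormal_familyD[OF u]
  show eq: "eigenspace M c = span (u ` {i. l i = c})"
  proof
    show "span (u ` {i. l i = c}) \<subseteq> eigenspace M c"
    proof (rule span_minimal)
      show "subspace (eigenspace M c)"
        by (auto simp: subspace_def eigenspace_def matrix_vector_right_distrib
            matrix_vector_mult_scaleR algebra_simps)
    qed (auto simp: eigenspace_def M)
  next
    have "x \<in> span (u ` {i. l i = c})" if "M *v x = c *\<^sub>R x" for x
    proof -
      have "M *v x = (\<Sum>i\<in>UNIV. (u i \<bullet> x) *\<^sub>R (l i *\<^sub>R u i))"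
        by (subst orthonormal_expansion[OF u, of x])
          (simp add: linear_sum[OF matrix_vector_mul_linear] matrix_vector_mult_scaleR M)
      then have "u j \<bullet> (M *v x) = l j * (u j \<bullet> x)" for j
        by (simp add: inner_sum_right ou if_distrib if_distribR cong: if_cong)
      then have "l j \<noteq> c \<Longrightarrow> u j \<bullet> x = 0" for j
        using that by (metis inner_scaleR_right mult_cancel_right)
      then have "(u i \<bullet> x) *\<^sub>R u i \<in> span (u ` {i. l i = c})" for i
        by (cases "l i = c") (auto intro: span_scale span_base span_zero)
      then show ?thesis
        by (subst orthonormal_expansion[OF u, of x]) (auto intro: span_sum)
    qed
    then show "eigenspace M c \<subseteq> span (u ` {i. l i = c})" by (auto simp: eigenspace_def)
  qed
  have inj: "inj u"
    by (rule injI) (metis ou(1) zero_neq_one)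
  have "pairwise orthogonal (u ` {i. l i = c})" "0 \<notin> u ` {i. l i = c}"
    using ou(2) by (auto simp: pairwise_def orthogonal_def ou(1)) (metis norm_zero zero_neq_one)
  then have "independent (u ` {i. l i = c})" by (rule pairwise_orthogonal_independent)
  then show "dim (eigenspace M c) = card {i. l i = c}"
    unfolding eq using inj by (simp add: dim_eq_card_independent card_image inj_on_subset)
qed

lemma image_mset_eq_sum_replicate:
  assumes "finite A"
  shows "image_mset f (mset_set A) = (\<Sum>c\<in>g ` A. image_mset f (mset_set {i \<in> A. g i = c}))"
proof -
  have single: "image_mset f (mset_set B) = (\<Sum>i\<in>B. {#f i#})" if "finite B" for B
    using that by (induction B) auto
  show ?thesis
    using assms by (simp add: single sum.image_gen[of A "\<lambda>i. {#f i#}" g])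
qed

text \<open>Whatever eigenbasis is chosen, the multiset in the definition of \<open>sing_val\<close>
  is that of all \<open>sqrt (l i)\<close>, grouped by eigenvalue. All later facts about singular
  values and the nuclear norm pass through these three statements.\<close>

lemma
  fixes X :: "real^'n^'m" and u :: "'m \<Rightarrow> real^'m"
  assumes "eigenbasis (X ** transpose X) u l"
  shows nuclear_norm_eigenbasis: "nuclear_norm X = (\<Sum>i\<in>UNIV. sqrt (l i))"
    and sing_val_mem: "k < CARD('m) \<Longrightarrow> sing_val X k \<in> range (\<lambda>i. sqrt (l i))"
    and sing_val_antimono_eigenbasis: "j \<le> k \<Longrightarrow> k < CARD('m) \<Longrightarrow> sing_val X k \<le> sing_val X j"
proof -
  let ?M = "X ** transpose X"
  have u: "orthonormal_family u" and M: "\<And>i. ?M *v u i = l i *\<^sub>R u i"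
    using assms by (auto simp: eigenbasis_def)
  define L where "L = image_mset (\<lambda>i. sqrt (l i)) (mset_set (UNIV :: 'm set))"
  define xs where "xs = rev (sorted_list_of_multiset L)"
  have "{c. \<exists>v\<in>eigenspace ?M c. v \<noteq> 0} = range l"
  proof -
    have "u i \<noteq> 0" for i using orthonormal_familyD(2)[OF u, of i] by auto
    then have "\<exists>v\<in>eigenspace ?M (l i). v \<noteq> 0" for i
      using M by (auto simp: eigenspace_def)
    moreover have "c \<in> range l" if "v \<in> eigenspace ?M c" "v \<noteq> 0" for c v
    proof (rule ccontr)
      assume "c \<notin> range l"
      then have "{i. l i = c} = {}" by auto
      then show False using that eigenspace_orthonormal_family(1)[where l = l, OF u M, of c] by simp
    qed
    ultimately show ?thesis by auto
  qed
  moreover have "L = (\<Sum>c\<in>range l. replicate_mset (card {i. l i = c}) (sqrt c))"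
  proof -
    have "image_mset (\<lambda>i. sqrt (l i)) (mset_set {i. l i = c}) =
        replicate_mset (card {i. l i = c}) (sqrt c)" for c
    proof -
      have "image_mset (\<lambda>i. sqrt (l i)) (mset_set {i. l i = c}) =
          image_mset (\<lambda>i. sqrt c) (mset_set {i. l i = c})"
        by (rule image_mset_cong) auto
      then show ?thesis by (simp add: image_mset_const_eq)
    qed
    then show ?thesis
      using image_mset_eq_sum_replicate[of UNIV "\<lambda>i. sqrt (l i)" l] by (simp add: L_def)
  qed
  ultimately have sv: "sing_val X k = xs ! k" for k
    unfolding sing_val_def xs_def by (simp add: eigenspace_orthonormal_family(2)[where l = l, OF u M])
  have mset: "mset xs = L" by (simp add: xs_def)
  then have len: "length xs = CARD('m)"
    by (metis L_def size_image_mset size_mset size_mset_set)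
  have "nuclear_norm X = sum_list xs"
    by (simp add: nuclear_norm_def sv sum_list_sum_nth len atLeast0LessThan)
  also have "\<dots> = sum_mset L" using mset by (metis sum_mset_sum_list)
  finally show "nuclear_norm X = (\<Sum>i\<in>UNIV. sqrt (l i))"
    by (simp add: L_def sum_unfold_sum_mset)
  show "sing_val X k \<in> range (\<lambda>i. sqrt (l i))" if "k < CARD('m)"
  proof -
    have "xs ! k \<in># L" using that len mset by (metis nth_mem_mset)
    then show ?thesis by (simp add: sv L_def)
  qed
  have "sorted (rev xs)" by (simp add: xs_def)
  then show "sing_val X k \<le> sing_val X j" if "j \<le> k" "k < CARD('m)"
    using that by (simp add: sv len sorted_rev_nth_mono)
qed

lemma gram_eigenbasis:
  fixes Z :: "real^'n^'m"
  assumes "eigenbasis (Z ** transpose Z) u l"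
  shows "(transpose Z *v u i) \<bullet> (transpose Z *v u j) = (if i = j then l i else 0)"
    and "0 \<le> l i"
proof -
  have gram: "(transpose Z *v u i) \<bullet> (transpose Z *v u j) = (if i = j then l i else 0)" for i j
  proof -
    have "(transpose Z *v u i) \<bullet> (transpose Z *v u j) = u i \<bullet> ((Z ** transpose Z) *v u j)"
      by (simp only: transpose_vector_inner matrix_vector_mul_assoc)
    also have "\<dots> = (if i = j then l i else 0)"
      using assms by (simp add: eigenbasis_def orthonormal_familyD(1))
    finally show ?thesis .
  qed
  then show "(transpose Z *v u i) \<bullet> (transpose Z *v u j) = (if i = j then l i else 0)" .
  show "0 \<le> l i" using gram[of i i] by (metis inner_ge_zero)
qed

lemma gram_eigenbasis_exists: "\<exists>u l. eigenbasis (Z ** transpose Z) u l" for Z :: "real^'n^'m"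
  by (rule symmetric_matrix_eigenbasis) (simp add: matrix_transpose_mul)

text \<open>A singular value decomposition without order, in which only the left vectors form a
  basis: \<open>v i\<close> is 0 when \<open>\<tau> i = 0\<close>. The right vectors thus need no
  completion, and the two dimensions need no comparison.\<close>

definition weak_svd ::
  "real^'n^'m \<Rightarrow> ('m \<Rightarrow> real^'m) \<Rightarrow> ('m \<Rightarrow> real) \<Rightarrow> ('m \<Rightarrow> real^'n) \<Rightarrow> bool" where
  "weak_svd Z u \<tau> v \<longleftrightarrow> orthonormal_family u \<and> (\<forall>i. 0 \<le> \<tau> i) \<and>
     (\<forall>i. transpose Z *v u i = \<tau> i *\<^sub>R v i) \<and>
     (\<forall>i j. v i \<bullet> v j = (if i = j \<and> \<tau> i \<noteq> 0 then 1 else 0))"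

lemma weak_svdD:
  assumes "weak_svd Z u \<tau> v"
  shows "orthonormal_family u" "0 \<le> \<tau> i" "transpose Z *v u i = \<tau> i *\<^sub>R v i"
    "v i \<bullet> v j = (if i = j \<and> \<tau> i \<noteq> 0 then 1 else 0)"
  using assms unfolding weak_svd_def by blast+

lemma weak_svd_exists:
  fixes Z :: "real^'n^'m"
  shows "\<exists>u \<tau> v. weak_svd Z u \<tau> v \<and> nuclear_norm Z = sum \<tau> UNIV"
proof -
  obtain u l where ul: "eigenbasis (Z ** transpose Z) u l"
    using gram_eigenbasis_exists by blast
  note gram = gram_eigenbasis[OF ul]
  \<comment> \<open>For \<open>l i = 0\<close> the quotient is 0 by convention, which gives the zero
    vector that \<open>weak_svd\<close> asks for.\<close>
  define v where "v i = (1 / sqrt (l i)) *\<^sub>R (transpose Z *v u i)" for i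
  have "transpose Z *v u i = sqrt (l i) *\<^sub>R v i" for i
    using gram(1)[of i i] by (cases "l i = 0") (auto simp: v_def)
  moreover have "v i \<bullet> v j = (if i = j \<and> sqrt (l i) \<noteq> 0 then 1 else 0)" for i j
    using gram(2)[of i] gram(2)[of j] unfolding v_def inner_scaleR_left inner_scaleR_right gram(1) by simp
  ultimately have "weak_svd Z u (\<lambda>i. sqrt (l i)) v"
    using ul gram(2) unfolding weak_svd_def eigenbasis_def by simp
  then show ?thesis using nuclear_norm_eigenbasis[OF ul] by blast
qed

lemma sing_val_nonneg:
  fixes X :: "real^'n^'m"
  assumes "k < CARD('m)"
  shows "0 \<le> sing_val X k"
proof -
  obtain u l where ul: "eigenbasis (X ** transpose X) u l"
    using gram_eigenbasis_exists by blast
  then show ?thesis using sing_val_mem[OF ul assms] gram_eigenbasis(2)[OF ul] by auto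
qed

lemma sing_val_antimono:
  fixes X :: "real^'n^'m"
  assumes "j \<le> k" "k < CARD('m)"
  shows "sing_val X k \<le> sing_val X j"
  using gram_eigenbasis_exists[of X] sing_val_antimono_eigenbasis[OF _ assms] by blast

lemma mem_spectral_ball: "Z \<in> spectral_ball \<longleftrightarrow> (\<forall>x. norm (Z *v x) \<le> norm x)"
  for Z :: "real^'n^'m"
proof
  assume "Z \<in> spectral_ball"
  then have "onorm ((*v) Z) \<le> 1" by (simp add: spectral_ball_def spectral_norm_def)
  then show "\<forall>x. norm (Z *v x) \<le> norm x"
    using onorm[OF matrix_vector_mul_bounded_linear, of Z]
    by (metis mult_left_le mult.commute norm_ge_zero order_trans)
next
  assume "\<forall>x. norm (Z *v x) \<le> norm x"
  then have "onorm ((*v) Z) \<le> 1" by (intro onorm_bound) auto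
  then show "Z \<in> spectral_ball" by (simp add: spectral_ball_def spectral_norm_def)
qed

lemma transpose_spectral_ball:
  fixes Z :: "real^'n^'m"
  assumes "Z \<in> spectral_ball"
  shows "transpose Z \<in> spectral_ball"
  unfolding mem_spectral_ball
proof
  fix x
  let ?y = "transpose Z *v x"
  have "norm ?y * norm ?y = x \<bullet> (Z *v ?y)"
    by (metis transpose_vector_inner power2_norm_eq_inner power2_eq_square)
  also have "\<dots> \<le> norm x * norm (Z *v ?y)" by (rule norm_cauchy_schwarz)
  also have "\<dots> \<le> norm x * norm ?y"
    using assms by (intro mult_left_mono) (auto simp: mem_spectral_ball)
  finally show "norm ?y \<le> norm x"
    by (cases "?y = 0") (auto simp: mult_le_cancel_right)
qed

lemma inner_le_nuclear_norm:
  fixes W Z :: "real^'n^'m"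
  assumes "Z \<in> spectral_ball"
  shows "W \<bullet> Z \<le> nuclear_norm W"
proof -
  obtain u \<tau> v where svd: "weak_svd W u \<tau> v" and n: "nuclear_norm W = sum \<tau> UNIV"
    using weak_svd_exists by blast
  note u = weak_svdD(1)[OF svd] and t = weak_svdD(2)[OF svd]
    and W = weak_svdD(3)[OF svd] and v = weak_svdD(4)[OF svd]
  have "v i \<bullet> (transpose Z *v u i) \<le> 1" for i
  proof -
    have "norm (v i) \<le> 1" using v[of i i] by (auto simp: norm_eq_sqrt_inner)
    moreover have "norm (transpose Z *v u i) \<le> 1"
      using transpose_spectral_ball[OF assms] orthonormal_familyD(2)[OF u]
      by (metis mem_spectral_ball)
    ultimately show ?thesis
      by (intro order_trans[OF norm_cauchy_schwarz]) (simp add: mult_le_one)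
  qed
  then have "\<tau> i * (v i \<bullet> (transpose Z *v u i)) \<le> \<tau> i" for i
    using t[of i] by (simp add: mult_left_le)
  then show ?thesis
    unfolding inner_matrix_orthonormal[OF u] W n inner_scaleR_left by (rule sum_mono)
qed

text \<open>The other half of the duality. Subadditivity, homogeneity and orthogonal invariance of
  the nuclear norm are obtained by testing with such a maximiser instead of comparing singular
  values.\<close>

lemma nuclear_norm_attained:
  fixes W :: "real^'n^'m"
  obtains Q where "Q \<in> spectral_ball" "W \<bullet> Q = nuclear_norm W"
proof -
  obtain u \<tau> v where svd: "weak_svd W u \<tau> v" and n: "nuclear_norm W = sum \<tau> UNIV"
    using weak_svd_exists by blast
  note u = weak_svdD(1)[OF svd]
    and W = weak_svdD(3)[OF svd] and v = weak_svdD(4)[OF svd]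
  \<comment> \<open>The partial isometry in the polar decomposition of \<open>W\<close>, i.e. the
    sum of the matrices u_i v_i^T; indices with \<open>\<tau> i = 0\<close> contribute nothing
    because \<open>v i = 0\<close>.\<close>
  define Q :: "real^'n^'m" where "Q = transpose (matrix (\<lambda>x. \<Sum>i\<in>UNIV. (u i \<bullet> x) *\<^sub>R v i))"
  have "linear (\<lambda>x. \<Sum>i\<in>UNIV. (u i \<bullet> x) *\<^sub>R v i)"
    by (intro linear_compose_sum ballI linearI) (auto simp: inner_add algebra_simps)
  then have Q: "transpose Q *v x = (\<Sum>i\<in>UNIV. (u i \<bullet> x) *\<^sub>R v i)" for x
    by (simp add: Q_def matrix_works)
  define e where "e i = (if \<tau> i \<noteq> 0 then 1 else 0 :: real)" for i
  have ve: "v i \<bullet> v j = (if i = j then e i else 0)" for i j by (simp add: v e_def)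
  have "norm (transpose Q *v x) \<le> norm x" for x
  proof (rule power2_le_imp_le)
    have "(norm (transpose Q *v x))\<^sup>2 = (\<Sum>i\<in>UNIV. (u i \<bullet> x)\<^sup>2 * e i)"
      unfolding Q power2_norm_eq_inner
      by (simp add: inner_sum_left inner_sum_right ve if_distrib[of "\<lambda>c. _ * c"] power2_eq_square
          mult.assoc cong: if_cong)
    also have "\<dots> \<le> (\<Sum>i\<in>UNIV. (u i \<bullet> x)\<^sup>2)" by (intro sum_mono) (simp add: e_def)
    finally show "(norm (transpose Q *v x))\<^sup>2 \<le> (norm x)\<^sup>2" by (simp add: parseval_norm[OF u])
  qed simp
  then have "transpose Q \<in> spectral_ball" by (simp add: mem_spectral_ball)
  then have "Q \<in> spectral_ball" using transpose_spectral_ball by fastforce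
  moreover have "W \<bullet> Q = nuclear_norm W"
  proof -
    have "transpose Q *v u j = v j" for j :: 'm
      unfolding Q by (simp add: orthonormal_familyD(1)[OF u] if_distrib if_distribR cong: if_cong)
    moreover have "\<tau> i * (v i \<bullet> v i) = \<tau> i" for i by (simp add: v)
    ultimately show ?thesis
      unfolding inner_matrix_orthonormal[OF u] W n inner_scaleR_left by (simp only:)
  qed
  ultimately show ?thesis using that by blast
qed

lemma nuclear_norm_add_le:
  fixes X Z :: "real^'n^'m"
  shows "nuclear_norm (X + Z) \<le> nuclear_norm X + nuclear_norm Z"
proof -
  obtain Q where "Q \<in> spectral_ball" "(X + Z) \<bullet> Q = nuclear_norm (X + Z)"
    by (rule nuclear_norm_attained)
  then show ?thesis
    using inner_le_nuclear_norm[of Q X] inner_le_nuclear_norm[of Q Z] by (simp add: inner_add_left)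
qed

lemma nuclear_norm_scaleR_le:
  fixes X :: "real^'n^'m"
  assumes "0 \<le> t"
  shows "nuclear_norm (t *\<^sub>R X) \<le> t * nuclear_norm X"
proof -
  obtain Q where "Q \<in> spectral_ball" "(t *\<^sub>R X) \<bullet> Q = nuclear_norm (t *\<^sub>R X)"
    by (rule nuclear_norm_attained)
  then show ?thesis
    using inner_le_nuclear_norm[of Q X] assms by (metis inner_scaleR_left mult_left_mono)
qed

lemma nuclear_norm_zero: "nuclear_norm (0 :: real^'n^'m) = 0"
  by (metis inner_zero_left nuclear_norm_attained)

text \<open>Subadditivity turns the subgradient inequality at \<open>X + Z\<close> into
  \<open>Y \<bullet> Z \<le> nuclear_norm Z\<close> for every \<open>Z\<close>. Rank-one
  \<open>Z\<close> then bound the spectral norm of \<open>Y\<close>, and \<open>Z = 0\<close> in the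
  original inequality gives the equality at \<open>X\<close>.\<close>

lemma subdifferential_nuclear_norm:
  fixes X Y :: "real^'n^'m"
  assumes "Y \<in> subdifferential nuclear_norm X"
  shows "Y \<in> spectral_ball" "Y \<bullet> X = nuclear_norm X"
proof -
  have sub: "nuclear_norm X + Y \<bullet> (Z - X) \<le> nuclear_norm Z" for Z
    using assms by (simp add: subdifferential_def)
  have le: "Y \<bullet> Z \<le> nuclear_norm Z" for Z
    using sub[of "X + Z"] nuclear_norm_add_le[of X Z] by simp
  show ball: "Y \<in> spectral_ball"
    unfolding mem_spectral_ball
  proof
    fix x
    define y where "y = Y *v x"
    \<comment> \<open>The rank-one matrix (Y x) x^T, on which \<open>Y\<close> takes the value |Y
      x|^2 and every matrix in the ball at most |Y x| |x|.\<close>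
    define Z :: "real^'n^'m" where "Z = (\<chi> i j. y $ i * x $ j)"
    have inner: "W \<bullet> Z = y \<bullet> (W *v x)" for W :: "real^'n^'m"
      by (simp add: Z_def inner_vec_def matrix_vector_mult_def sum_distrib_left mult_ac)
    obtain Q where Q: "Q \<in> spectral_ball" "Z \<bullet> Q = nuclear_norm Z"
      by (rule nuclear_norm_attained)
    have "norm y * norm y = Y \<bullet> Z"
      unfolding inner y_def by (metis power2_eq_square power2_norm_eq_inner)
    also have "\<dots> \<le> y \<bullet> (Q *v x)" using le[of Z] Q(2) inner[of Q] by (simp add: inner_commute)
    also have "\<dots> \<le> norm y * norm (Q *v x)" by (rule norm_cauchy_schwarz)
    also have "\<dots> \<le> norm y * norm x"
      using Q(1) by (intro mult_left_mono) (auto simp: mem_spectral_ball)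
    finally show "norm (Y *v x) \<le> norm x"
      by (cases "y = 0") (auto simp: mult_le_cancel_left y_def)
  qed
  show "Y \<bullet> X = nuclear_norm X"
    using sub[of 0] le[of X] by (simp add: nuclear_norm_zero inner_diff_right)
qed

text \<open>One direction tests the cone inequality at a maximiser of the inner product with
  \<open>X\<close> over the ball; the other is the duality inequality.\<close>

lemma mem_normal_cone_spectral_ball:
  fixes X Y :: "real^'n^'m"
  assumes "Y \<in> spectral_ball"
  shows "X \<in> normal_cone spectral_ball Y \<longleftrightarrow> nuclear_norm X = Y \<bullet> X"
proof
  assume X: "X \<in> normal_cone spectral_ball Y"
  obtain Q where "Q \<in> spectral_ball" "X \<bullet> Q = nuclear_norm X" by (rule nuclear_norm_attained)
  then show "nuclear_norm X = Y \<bullet> X"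
    using X inner_le_nuclear_norm[OF assms, of X]
    by (force simp: normal_cone_def inner_diff_right inner_commute)
next
  assume "nuclear_norm X = Y \<bullet> X"
  then show "X \<in> normal_cone spectral_ball Y"
    using inner_le_nuclear_norm[of _ X]
    by (auto simp: normal_cone_def inner_diff_right inner_commute)
qed

section \<open>Orthogonal invariance of the nuclear and Frobenius norms\<close>

lemma inner_matrix_mult_left:
  fixes A :: "real^'k^'m" and X :: "real^'n^'k" and Z :: "real^'n^'m"
  shows "(A ** X) \<bullet> Z = X \<bullet> (transpose A ** Z)"
  by (simp add: inner_matrix_eq_trace matrix_transpose_mul matrix_mul_assoc)

lemma inner_matrix_mult_right:
  fixes X :: "real^'k^'m" and B :: "real^'n^'k" and Z :: "real^'n^'m"
  shows "(X ** B) \<bullet> Z = X \<bullet> (Z ** transpose B)"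
proof -
  have "trace (transpose B ** (transpose X ** Z)) = trace ((transpose X ** Z) ** transpose B)"
    by (rule trace_mul_sym)
  then show ?thesis by (simp add: inner_matrix_eq_trace matrix_transpose_mul matrix_mul_assoc)
qed

lemma inner_matrix_conjugate:
  fixes P :: "real^'k^'m" and X :: "real^'l^'k" and Q :: "real^'n^'l" and W :: "real^'n^'m"
  shows "(P ** X ** Q) \<bullet> W = X \<bullet> (transpose P ** W ** transpose Q)"
  by (subst inner_matrix_mult_right, subst inner_matrix_mult_left) (simp only: matrix_mul_assoc)

lemma norm_orthogonal_matrix:
  fixes P :: "real^'n^'n"
  assumes "orthogonal_matrix P"
  shows "norm (P *v x) = norm x"
  using assms orthogonal_transformation_matrix[of "(*v) P"] orthogonal_transformation_norm
  by (metis matrix_of_matrix_vector_mul matrix_vector_mul_linear)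

lemma orthogonal_conjugate_cancel:
  fixes P :: "real^'m^'m" and Q :: "real^'n^'n" and X :: "real^'n^'m"
  assumes "orthogonal_matrix P" "orthogonal_matrix Q"
  shows "transpose P ** (P ** X ** transpose Q) ** Q = X"
    "P ** (transpose P ** X ** Q) ** transpose Q = X"
proof -
  note o = assms[unfolded orthogonal_matrix_def]
  have "transpose P ** (P ** X ** transpose Q) ** Q
      = (transpose P ** P) ** X ** (transpose Q ** Q)"
    by (simp only: matrix_mul_assoc)
  then show "transpose P ** (P ** X ** transpose Q) ** Q = X" by (simp add: o)
  have "P ** (transpose P ** X ** Q) ** transpose Q
      = (P ** transpose P) ** X ** (Q ** transpose Q)"
    by (simp only: matrix_mul_assoc)
  then show "P ** (transpose P ** X ** Q) ** transpose Q = X" by (simp add: o)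
qed

lemma nuclear_norm_orthogonal_le:
  fixes P :: "real^'m^'m" and Q :: "real^'n^'n" and X :: "real^'n^'m"
  assumes "orthogonal_matrix P" "orthogonal_matrix Q"
  shows "nuclear_norm (P ** X ** Q) \<le> nuclear_norm X"
proof -
  obtain W where W: "W \<in> spectral_ball" "(P ** X ** Q) \<bullet> W = nuclear_norm (P ** X ** Q)"
    by (rule nuclear_norm_attained)
  have "norm ((transpose P ** W ** transpose Q) *v x) \<le> norm x" for x
  proof -
    have "norm ((transpose P ** W ** transpose Q) *v x) = norm (W *v (transpose Q *v x))"
      using norm_orthogonal_matrix[of "transpose P"] assms
      by (simp only: matrix_vector_mul_assoc[symmetric] orthogonal_matrix_transpose)
    also have "\<dots> \<le> norm (transpose Q *v x)" using W(1) by (simp only: mem_spectral_ball)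
    also have "\<dots> = norm x"
      using norm_orthogonal_matrix[of "transpose Q"] assms by (simp only: orthogonal_matrix_transpose)
    finally show ?thesis .
  qed
  then have "transpose P ** W ** transpose Q \<in> spectral_ball" unfolding mem_spectral_ball by blast
  moreover have "(P ** X ** Q) \<bullet> W = X \<bullet> (transpose P ** W ** transpose Q)"
    by (rule inner_matrix_conjugate)
  ultimately show ?thesis using inner_le_nuclear_norm W(2) by metis
qed

lemma nuclear_norm_orthogonal:
  fixes P :: "real^'m^'m" and Q :: "real^'n^'n" and X :: "real^'n^'m"
  assumes "orthogonal_matrix P" "orthogonal_matrix Q"
  shows "nuclear_norm (transpose P ** X ** Q) = nuclear_norm X"
proof (rule antisym)
  show "nuclear_norm (transpose P ** X ** Q) \<le> nuclear_norm X"
    using assms by (intro nuclear_norm_orthogonal_le) simp_all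
  have "nuclear_norm (P ** (transpose P ** X ** Q) ** transpose Q)
      \<le> nuclear_norm (transpose P ** X ** Q)"
    using assms by (intro nuclear_norm_orthogonal_le) simp_all
  then show "nuclear_norm X \<le> nuclear_norm (transpose P ** X ** Q)"
    by (simp only: orthogonal_conjugate_cancel[OF assms])
qed

lemma norm_orthogonal_conjugate:
  fixes P :: "real^'m^'m" and Q :: "real^'n^'n" and X :: "real^'n^'m"
  assumes "orthogonal_matrix P" "orthogonal_matrix Q"
  shows "norm (P ** X ** transpose Q) = norm X"
proof -
  have "(P ** X ** transpose Q) \<bullet> (P ** X ** transpose Q)
      = X \<bullet> (transpose P ** (P ** X ** transpose Q) ** Q)"
    by (simp only: inner_matrix_conjugate transpose_transpose)
  then show ?thesis by (simp only: norm_eq_sqrt_inner orthogonal_conjugate_cancel[OF assms])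
qed

section \<open>Positions in a finite linear order\<close>

lemma bij_betw_pos: "bij_betw pos (UNIV :: 'n::{finite,linorder} set) {..<CARD('n)}"
proof -
  have less: "pos i < pos j" if "i < j" for i j :: 'n
    unfolding pos_def using that by (intro psubset_card_mono) auto
  then have inj: "inj (pos :: 'n \<Rightarrow> nat)"
    by (intro injI) (metis less_irrefl linorder_less_linear)
  have "pos i < CARD('n)" for i :: 'n
    unfolding pos_def by (intro psubset_card_mono) auto
  then have "range (pos :: 'n \<Rightarrow> nat) = {..<CARD('n)}"
    using inj by (intro card_subset_eq) (auto simp: card_image)
  then show ?thesis using inj by (simp add: bij_betw_def)
qed

lemma pos_less: "pos (i :: 'n::{finite,linorder}) < CARD('n)"
  using bij_betw_pos by (auto simp: bij_betw_def)

lemma pos_eq_iff [simp]: "pos i = pos j \<longleftrightarrow> i = j" for i j :: "'n::{finite,linorder}"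
  using bij_betw_pos by (auto simp: bij_betw_def inj_on_def)

lemma pos_ex: "k < CARD('n) \<Longrightarrow> \<exists>i :: 'n::{finite,linorder}. pos i = k"
  using bij_betw_pos by (metis bij_betw_def imageE lessThan_iff)

lemma sum_pos: "(\<Sum>i\<in>(UNIV :: 'n::{finite,linorder} set). f (pos i)) = (\<Sum>k<CARD('n). f k)"
  using sum.reindex_bij_betw[OF bij_betw_pos] .

lemma card_pos_Collect: "card {i :: 'n::{finite,linorder}. Q (pos i)} = card {k. k < CARD('n) \<and> Q k}"
proof -
  have "bij_betw pos {i :: 'n. Q (pos i)} {k. k < CARD('n) \<and> Q k}"
    by (rule bij_betw_subset[OF bij_betw_pos]) (auto simp: pos_less dest: pos_ex)
  then show ?thesis by (rule bij_betw_same_card)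
qed

section \<open>Quadratic growth of the nuclear norm\<close>

text \<open>The matrix E = (I 0). Rectangular diagonal and corner matrices are square ones times E,
  so that spectral arguments can be carried out on square symmetric matrices.\<close>

definition row_isometry :: "real^('n::{finite,linorder})^('m::{finite,linorder})" where
  "row_isometry = rect_diag (\<lambda>_. 1)"

lemma matrix_mul_row_isometry:
  fixes A :: "real^('m::{finite,linorder})^('k::{finite,linorder})"
  shows "(A ** (row_isometry :: real^('n::{finite,linorder})^('m::{finite,linorder}))) $ i $ j =
    (\<Sum>k\<in>UNIV. A $ i $ k * (if pos k = pos j then 1 else 0))"
  by (simp add: matrix_matrix_mult_def row_isometry_def rect_diag_def)

lemma rect_diag_factor:
  "rect_diag s = (rect_diag s :: real^('m::{finite,linorder})^('m::{finite,linorder})) **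
     (row_isometry :: real^('n::{finite,linorder})^('m::{finite,linorder}))"
  unfolding vec_eq_iff matrix_mul_row_isometry
proof (intro allI)
  fix i :: 'm and j :: 'n
  have "(rect_diag s :: real^('m::{finite,linorder})^('m::{finite,linorder})) $ i $ k * (if pos k = pos j then 1 else 0) =
      (if k = i then rect_diag s $ i $ j else 0)" for k
    by (auto simp: rect_diag_def)
  then show "rect_diag s $ i $ j = (\<Sum>k\<in>UNIV. (rect_diag s :: real^('m::{finite,linorder})^('m::{finite,linorder})) $ i $ k *
      (if pos k = pos j then 1 else 0))"
    by simp
qed

lemma corner_factor:
  assumes "p \<le> CARD('m)"
  shows "corner p M = (corner p M :: real^('m::{finite,linorder})^('m::{finite,linorder})) **
     (row_isometry :: real^('n::{finite,linorder})^('m::{finite,linorder}))"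
  unfolding vec_eq_iff matrix_mul_row_isometry
proof (intro allI)
  fix i :: 'm and j :: 'n
  show "corner p M $ i $ j = (\<Sum>k\<in>UNIV. (corner p M :: real^('m::{finite,linorder})^('m::{finite,linorder})) $ i $ k *
      (if pos k = pos j then 1 else 0))"
  proof (cases "pos j < p")
    case True
    then obtain k0 :: 'm where k0: "pos k0 = pos j" using pos_ex assms by (metis order_less_le_trans)
    then have "(corner p M :: real^('m::{finite,linorder})^('m::{finite,linorder})) $ i $ k * (if pos k = pos j then 1 else 0) =
        (if k = k0 then corner p M $ i $ j else 0)" for k
      by (auto simp: corner_def simp flip: k0)
    then show ?thesis by simp
  next
    case False
    then show ?thesis by (simp add: corner_def) (intro sum.neutral, auto)
  qed
qed

text \<open>Every row position is also a column position when there are at most as many rows as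
  columns, so the rows of E are distinct unit vectors.\<close>

lemma row_isometry_transpose:
  assumes "CARD('m) \<le> CARD('n)"
  shows "(row_isometry :: real^('n::{finite,linorder})^('m::{finite,linorder})) **
    transpose row_isometry = mat 1"
proof -
  let ?E = "row_isometry :: real^('n::{finite,linorder})^('m::{finite,linorder})"
  have "(\<Sum>j\<in>UNIV. (if pos i = pos (j :: 'n) then 1 else 0) * (if pos k = pos j then 1 else 0)) =
      (if i = k then 1 else 0 :: real)" for i k :: 'm
  proof -
    obtain j0 :: 'n where j0: "pos j0 = pos i"
      using assms pos_ex pos_less by (metis order_less_le_trans)
    then have "(if pos i = pos j then 1 else 0) * (if pos k = pos j then 1 else 0) =
        (if j = j0 then (if i = k then 1 else 0 :: real) else 0)" for j :: 'n
      by (auto simp flip: j0) (metis j0 pos_eq_iff)+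
    then show ?thesis by simp
  qed
  then show ?thesis
    by (simp add: matrix_matrix_mult_def row_isometry_def rect_diag_def transpose_def mat_def)
qed

lemma norm_row_isometry:
  fixes x :: "real^('m::{finite,linorder})"
  assumes "CARD('m) \<le> CARD('n)"
  shows "norm (transpose (row_isometry :: real^('n::{finite,linorder})^('m::{finite,linorder})) *v x) = norm x"
  unfolding norm_eq_sqrt_inner transpose_vector_inner matrix_vector_mul_assoc
    row_isometry_transpose[OF assms] by simp

lemma rect_diag_square_mult: "(rect_diag s *v x) $ i = s (pos i) * x $ i"
  for x :: "real^('m::{finite,linorder})"
  by (simp add: matrix_vector_mult_def rect_diag_def if_distrib if_distribR cong: if_cong)

lemma transpose_rect_diag: "transpose (rect_diag s) = (rect_diag s :: real^('m::{finite,linorder})^('m::{finite,linorder}))"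
  by (auto simp: transpose_def rect_diag_def vec_eq_iff)

text \<open>The cone of positive semidefinite p x p matrices, embedded in the full square format:
  \<open>p\<close> is a number and not a type, so the size is expressed by the support.\<close>

definition psd_corner :: "nat \<Rightarrow> (real^('m::{finite,linorder})^('m::{finite,linorder})) set" where
  "psd_corner p = {S. transpose S = S \<and> (\<forall>x. 0 \<le> x \<bullet> (S *v x)) \<and>
     (\<forall>i j. S $ i $ j \<noteq> 0 \<longrightarrow> pos i < p \<and> pos j < p)}"

definition outer :: "real^'m \<Rightarrow> real^'n \<Rightarrow> real^'n^'m" where
  "outer x y = (\<chi> i j. x $ i * y $ j)"

lemma norm_outer: "norm (outer x y) = norm x * norm y"
proof -
  have "(\<Sum>i\<in>UNIV. \<Sum>j\<in>UNIV. (x $ i * y $ j) * (x $ i * y $ j)) =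
      (\<Sum>i\<in>UNIV. x $ i * x $ i) * (\<Sum>j\<in>UNIV. y $ j * y $ j)"
    unfolding sum_product by (simp add: mult_ac)
  then have "outer x y \<bullet> outer x y = (x \<bullet> x) * (y \<bullet> y)"
    by (simp add: outer_def inner_vec_def)
  then show ?thesis by (simp add: norm_eq_sqrt_inner real_sqrt_mult)
qed

lemma outer_diff: "outer x y - outer x' y' = outer x (y - y') + outer (x - x') y'"
  by (simp add: outer_def vec_eq_iff algebra_simps)

lemma outer_mul: "outer x y ** A = outer x (transpose A *v y)"
  by (simp add: outer_def vec_eq_iff matrix_matrix_mult_def matrix_vector_mult_def transpose_def
      sum_distrib_left mult_ac)

lemma outer_mulv: "outer x y *v z = (y \<bullet> z) *\<^sub>R x"
  by (simp add: outer_def vec_eq_iff matrix_vector_mult_def inner_vec_def sum_distrib_left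
      sum_distrib_right mult_ac)

lemma transpose_outer: "transpose (outer x y) = outer y x"
  by (simp add: outer_def vec_eq_iff transpose_def)

lemma transpose_sum_scaleR:
  fixes F :: "'i \<Rightarrow> real^'n^'m"
  shows "transpose (\<Sum>i\<in>I. c i *\<^sub>R F i) = (\<Sum>i\<in>I. c i *\<^sub>R transpose (F i))"
  by (simp add: transpose_def vec_eq_iff)

lemma sum_scaleR_mulv:
  fixes F :: "'i \<Rightarrow> real^'n^'m"
  shows "(\<Sum>i\<in>I. c i *\<^sub>R F i) *v x = (\<Sum>i\<in>I. c i *\<^sub>R (F i *v x))"
  by (induction I rule: infinite_finite_induct)
    (auto simp: matrix_vector_mult_add_rdistrib scaleR_matrix_vector_assoc)

lemma weak_svd_outer:
  fixes Z :: "real^'n^'m"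
  assumes "weak_svd Z u \<tau> v"
  shows "Z = (\<Sum>i\<in>UNIV. \<tau> i *\<^sub>R outer (u i) (v i))"
proof -
  note svd = weak_svdD[OF assms]
  have "transpose Z *v x = (\<Sum>i\<in>UNIV. \<tau> i *\<^sub>R outer (v i) (u i)) *v x" for x
  proof -
    have "transpose Z *v x = (\<Sum>i\<in>UNIV. (u i \<bullet> x) *\<^sub>R (transpose Z *v u i))"
      by (subst orthonormal_expansion[OF svd(1), of x])
        (simp only: linear_sum[OF matrix_vector_mul_linear] matrix_vector_mult_scaleR)
    then show ?thesis by (simp only: svd(3) sum_scaleR_mulv outer_mulv scaleR_scaleR mult.commute)
  qed
  then have "transpose Z = (\<Sum>i\<in>UNIV. \<tau> i *\<^sub>R outer (v i) (u i))" by (simp only: matrix_eq) simp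
  then have "transpose (transpose Z) = transpose (\<Sum>i\<in>UNIV. \<tau> i *\<^sub>R outer (v i) (u i))" by simp
  then show ?thesis by (simp only: transpose_sum_scaleR transpose_outer transpose_transpose)
qed

lemma weighted_Cauchy_Schwarz:
  fixes t c :: "'i \<Rightarrow> real"
  assumes "\<And>i. i \<in> I \<Longrightarrow> 0 \<le> t i"
  shows "(\<Sum>i\<in>I. t i * c i)\<^sup>2 \<le> (\<Sum>i\<in>I. t i) * (\<Sum>i\<in>I. t i * (c i)\<^sup>2)"
proof -
  have "(\<Sum>i\<in>I. t i * c i) = (\<Sum>i\<in>I. sqrt (t i) * (sqrt (t i) * c i))"
    using assms by (intro sum.cong) (auto simp flip: mult.assoc)
  then have "(\<Sum>i\<in>I. t i * c i)\<^sup>2 \<le> (\<Sum>i\<in>I. (sqrt (t i))\<^sup>2) * (\<Sum>i\<in>I. (sqrt (t i) * c i)\<^sup>2)"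
    by (simp only: Cauchy_Schwarz_ineq_sum)
  also have "\<dots> = (\<Sum>i\<in>I. t i) * (\<Sum>i\<in>I. t i * (c i)\<^sup>2)"
    using assms by (simp add: power_mult_distrib)
  finally show ?thesis .
qed

text \<open>With D = \<open>rect_diag s\<close>, the gap is the sum of
  \<open>\<tau> i * g i\<close>, where \<open>g i = 1 - (transpose D *v u i) \<bullet> v i\<close>
  measures how far the i-th singular pair is from being aligned by D. Each \<open>g i\<close>
  controls two squared errors: the distance of v_i from D^T u_i, and the part of u_i beyond the
  first \<open>p\<close> coordinates, where D contracts strictly.\<close>

lemma nuclear_norm_quadratic_growth:
  fixes Z :: "real^('n::{finite,linorder})^('m::{finite,linorder})"
  assumes card: "CARD('m) \<le> CARD('n)"
    and s: "\<And>k. k < p \<Longrightarrow> s k = 1"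
    and s': "\<And>k. p \<le> k \<Longrightarrow> k < CARD('m) \<Longrightarrow> (s k)\<^sup>2 \<le> 1 - \<delta>"
    and \<delta>: "0 < \<delta>" "\<delta> \<le> 1"
  obtains S :: "real^('m::{finite,linorder})^('m::{finite,linorder})" where "S \<in> psd_corner p"
    "(norm (Z - S ** row_isometry))\<^sup>2 \<le>
       10 / \<delta> * nuclear_norm Z * (nuclear_norm Z - rect_diag s \<bullet> Z)"
proof -
  obtain u \<tau> v where svd: "weak_svd Z u \<tau> v" and n: "nuclear_norm Z = sum \<tau> UNIV"
    using weak_svd_exists by blast
  note u = weak_svdD(1)[OF svd] and t = weak_svdD(2)[OF svd]
    and Z = weak_svdD(3)[OF svd] and v = weak_svdD(4)[OF svd]
  let ?E = "row_isometry :: real^('n::{finite,linorder})^('m::{finite,linorder})"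
  define D :: "real^('n::{finite,linorder})^('m::{finite,linorder})" where "D = rect_diag s"
  \<comment> \<open>Truncating the left vectors gives the candidate \<open>S\<close>, the sum of
    \<open>\<tau> i\<close> times w_i w_i^T. It is semidefinite and supported in the corner by
    construction.\<close>
  define w where "w i = (\<chi> k. if pos k < p then u i $ k else 0)" for i
  define S where "S = (\<Sum>i\<in>UNIV. \<tau> i *\<^sub>R outer (w i) (w i))"
  have "S \<in> psd_corner p"
    unfolding psd_corner_def
  proof (intro CollectI conjI allI impI)
    show "transpose S = S" by (simp only: S_def transpose_sum_scaleR transpose_outer)
    show "0 \<le> x \<bullet> (S *v x)" for x
      using t unfolding S_def sum_scaleR_mulv outer_mulv inner_sum_right inner_scaleR_right
      by (intro sum_nonneg mult_nonneg_nonneg[OF t]) (simp add: inner_commute)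
    show "pos i < p" "pos j < p" if "S $ i $ j \<noteq> 0" for i j
    proof -
      have "S $ i $ j = (\<Sum>k\<in>UNIV. \<tau> k * (w k $ i * w k $ j))" by (simp add: S_def outer_def)
      then have "\<exists>k. w k $ i * w k $ j \<noteq> 0"
        using that by (cases "\<forall>k. w k $ i * w k $ j = 0") simp_all
      then show "pos i < p" "pos j < p" by (auto simp: w_def split: if_splits)
    qed
  qed
  define a b where "a i = norm (v i - transpose D *v u i)" and "b i = norm (u i - w i)" for i
  define g where "g i = 1 - (transpose D *v u i) \<bullet> v i" for i
  have DT: "transpose D *v x = transpose ?E *v (rect_diag s *v x)" for x
    unfolding D_def
    by (subst rect_diag_factor)
      (simp only: matrix_transpose_mul transpose_rect_diag matrix_vector_mul_assoc)
  have gap: "nuclear_norm Z - D \<bullet> Z = (\<Sum>i\<in>UNIV. \<tau> i * g i)"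
    unfolding inner_matrix_orthonormal[OF u] Z n g_def inner_scaleR_right
    by (simp add: sum_subtractf right_diff_distrib)
  \<comment> \<open>D acts as the identity on the first \<open>p\<close> coordinates and does not
    enlarge the others, which are precisely those that \<open>w i\<close> drops.\<close>
  have Du: "norm (transpose D *v u i - transpose ?E *v w i) \<le> b i" for i
  proof -
    have "norm (transpose D *v u i - transpose ?E *v w i) = norm (rect_diag s *v u i - w i)"
      unfolding DT by (metis norm_row_isometry[OF card] matrix_vector_mult_diff_distrib)
    also have "\<dots> \<le> b i"
      unfolding b_def
    proof (rule norm_le_componentwise_cart)
      fix k :: 'm
      have "\<bar>s (pos k)\<bar> \<le> 1" if "\<not> pos k < p"
        using s'[of "pos k"] that pos_less[of k] \<delta> abs_square_le_1[of "s (pos k)"] by simp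
      then show "norm ((rect_diag s *v u i - w i) $ k) \<le> norm ((u i - w i) $ k)"
        using s[of "pos k"]
        by (auto simp: rect_diag_square_mult w_def abs_mult mult_left_le_one_le)
    qed
    finally show ?thesis .
  qed
  have wn: "norm (w i) \<le> 1" for i
  proof -
    have "norm (w i) \<le> norm (u i)" by (rule norm_le_componentwise_cart) (simp add: w_def)
    then show ?thesis by (simp add: orthonormal_familyD(2)[OF u])
  qed
  \<comment> \<open>The constant 10: expanding \<open>a i\<close> gives a^2 + \<delta> b^2 \<le> 2
    g, hence \<delta> (a^2 + b^2) \<le> 2 g as \<delta> \<le> 1, and (a + 2 b)^2 \<le> 5 (a^2 +
    b^2). A nonzero \<open>\<tau> i\<close> makes \<open>v i\<close> a unit vector.\<close>
  have g: "(a i + 2 * b i)\<^sup>2 \<le> 10 / \<delta> * g i" if "\<tau> i \<noteq> 0" for i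
  proof -
    have v1: "v i \<bullet> v i = 1" using v[of i i] that by simp
    have "(a i)\<^sup>2 = 1 - 2 * ((transpose D *v u i) \<bullet> v i) + (norm (transpose D *v u i))\<^sup>2"
      unfolding a_def power2_norm_eq_inner inner_diff_left inner_diff_right v1
      by (simp add: inner_commute[of "v i"])
    moreover have "\<delta> * (b i)\<^sup>2 \<le> 1 - (norm (transpose D *v u i))\<^sup>2"
    proof -
      have "(norm (transpose D *v u i))\<^sup>2 = (norm (rect_diag s *v u i :: real^('m::{finite,linorder})))\<^sup>2"
        unfolding DT norm_row_isometry[OF card] ..
      also have "\<dots> = (\<Sum>k\<in>UNIV. (s (pos k))\<^sup>2 * (u i $ k)\<^sup>2)"
        unfolding power2_norm_eq_inner by (simp add: inner_vec_def rect_diag_square_mult power2_eq_square mult_ac)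
      finally have N: "(norm (transpose D *v u i))\<^sup>2 = (\<Sum>k\<in>UNIV. (s (pos k))\<^sup>2 * (u i $ k)\<^sup>2)" .
      have b: "(b i)\<^sup>2 = (\<Sum>k\<in>UNIV. if pos k < p then 0 else (u i $ k)\<^sup>2)"
        unfolding b_def power2_norm_eq_inner inner_vec_def
        by (intro sum.cong) (auto simp: w_def power2_eq_square)
      have "(norm (u i))\<^sup>2 = (\<Sum>k\<in>UNIV. (u i $ k)\<^sup>2)"
        unfolding power2_norm_eq_inner by (simp add: inner_vec_def power2_eq_square)
      then have one: "(\<Sum>k\<in>UNIV. (u i $ k)\<^sup>2) = 1" by (simp add: orthonormal_familyD(2)[OF u])
      have "\<delta> * (b i)\<^sup>2 + (norm (transpose D *v u i))\<^sup>2 =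
          (\<Sum>k\<in>UNIV. (if pos k < p then 0 else \<delta> * (u i $ k)\<^sup>2) + (s (pos k))\<^sup>2 * (u i $ k)\<^sup>2)"
        unfolding N b sum_distrib_left sum.distrib[symmetric] by (intro sum.cong) auto
      also have "\<dots> \<le> (\<Sum>k\<in>UNIV. (u i $ k)\<^sup>2)"
      proof (intro sum_mono)
        fix k
        show "(if pos k < p then 0 else \<delta> * (u i $ k)\<^sup>2) + (s (pos k))\<^sup>2 * (u i $ k)\<^sup>2 \<le> (u i $ k)\<^sup>2"
        proof (cases "pos k < p")
          case False
          then have "\<delta> + (s (pos k))\<^sup>2 \<le> 1" using s'[of "pos k"] pos_less[of k] by simp
          then have "(\<delta> + (s (pos k))\<^sup>2) * (u i $ k)\<^sup>2 \<le> 1 * (u i $ k)\<^sup>2"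
            by (intro mult_right_mono) auto
          then show ?thesis using False by (simp add: algebra_simps)
        qed (simp add: s)
      qed
      finally show ?thesis using one by simp
    qed
    ultimately have "(a i)\<^sup>2 + \<delta> * (b i)\<^sup>2 \<le> 2 * g i" by (simp add: g_def)
    moreover have "\<delta> * (a i)\<^sup>2 \<le> (a i)\<^sup>2" using \<delta> by (simp add: mult_left_le_one_le)
    ultimately have "\<delta> * (5 * (a i)\<^sup>2 + 5 * (b i)\<^sup>2) \<le> 10 * g i" by (simp add: algebra_simps)
    moreover have "(a i + 2 * b i)\<^sup>2 \<le> 5 * (a i)\<^sup>2 + 5 * (b i)\<^sup>2"
      using zero_le_power2[of "2 * a i - b i"] by (simp add: power2_eq_square algebra_simps)
    ultimately have "\<delta> * (a i + 2 * b i)\<^sup>2 \<le> 10 * g i"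
      using \<delta>(1) by (meson mult_left_mono less_imp_le order_trans)
    then show ?thesis using \<delta>(1) by (simp add: field_simps)
  qed
  have "Z - S ** ?E = (\<Sum>i\<in>UNIV. \<tau> i *\<^sub>R (outer (u i) (v i) - outer (w i) (transpose ?E *v w i)))"
  proof -
    have "S ** ?E = (\<Sum>i\<in>UNIV. \<tau> i *\<^sub>R (outer (w i) (w i) ** ?E))"
      unfolding S_def vec_eq_iff
      by (simp add: matrix_matrix_mult_def sum_distrib_right sum_distrib_left mult_ac)
        (intro allI sum.swap)
    then show ?thesis
      by (subst weak_svd_outer[OF svd]) (simp add: outer_mul scaleR_diff_right sum_subtractf)
  qed
  also have "norm \<dots> \<le> (\<Sum>i\<in>UNIV. \<tau> i * (a i + 2 * b i))"
  proof (intro sum_norm_le)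
    fix i
    \<comment> \<open>Replace the right factor first, at cost |v_i - E^T w_i| \<le> a_i + b_i, then
      the left one, at cost |u_i - w_i| |w_i| \<le> b_i.\<close>
    have "norm (outer (u i) (v i) - outer (w i) (transpose ?E *v w i)) \<le> a i + 2 * b i"
    proof -
      have "norm (outer (u i) (v i) - outer (w i) (transpose ?E *v w i)) \<le>
          norm (v i - transpose ?E *v w i) + norm (u i - w i) * norm (w i)"
        unfolding outer_diff
        by (rule order_trans[OF norm_triangle_ineq])
          (simp only: norm_outer orthonormal_familyD(2)[OF u] norm_row_isometry[OF card] mult_1_left)
      also have "norm (v i - transpose ?E *v w i) \<le> a i + b i"
        using Du[of i] norm_triangle_ineq[of "v i - transpose D *v u i"
            "transpose D *v u i - transpose ?E *v w i"]
        by (simp only: a_def diff_add_cancel add_diff_eq)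
      also have "norm (u i - w i) * norm (w i) \<le> b i"
        using wn[of i] by (simp add: b_def mult_left_le)
      finally show ?thesis by simp
    qed
    then show "norm (\<tau> i *\<^sub>R (outer (u i) (v i) - outer (w i) (transpose ?E *v w i)))
        \<le> \<tau> i * (a i + 2 * b i)"
      using t[of i] by (simp only: norm_scaleR abs_of_nonneg) (rule mult_left_mono)
  qed
  finally have "(norm (Z - S ** ?E))\<^sup>2 \<le> (\<Sum>i\<in>UNIV. \<tau> i * (a i + 2 * b i))\<^sup>2"
    by (rule power_mono) simp
  \<comment> \<open>Cauchy-Schwarz with weights \<open>\<tau> i\<close>: the total weight is the
    nuclear norm of \<open>Z\<close>, which is how this factor enters the estimate.\<close>
  also have "\<dots> \<le> (\<Sum>i\<in>UNIV. \<tau> i) * (\<Sum>i\<in>UNIV. \<tau> i * (a i + 2 * b i)\<^sup>2)"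
    using t by (intro weighted_Cauchy_Schwarz)
  also have "\<dots> \<le> (\<Sum>i\<in>UNIV. \<tau> i) * (\<Sum>i\<in>UNIV. \<tau> i * (10 / \<delta> * g i))"
  proof (rule mult_left_mono[OF sum_mono])
    show "\<tau> i * (a i + 2 * b i)\<^sup>2 \<le> \<tau> i * (10 / \<delta> * g i)" for i
    proof (cases "\<tau> i = 0")
      case False
      then show ?thesis using mult_left_mono[OF g[of i] t[of i]] by blast
    qed simp
    show "0 \<le> sum \<tau> UNIV" using t by (intro sum_nonneg) auto
  qed
  also have "(\<Sum>i\<in>UNIV. \<tau> i * (10 / \<delta> * g i)) = 10 / \<delta> * (\<Sum>i\<in>UNIV. \<tau> i * g i)"
    by (simp add: sum_distrib_left mult_ac)
  finally have "(norm (Z - S ** ?E))\<^sup>2 \<le> 10 / \<delta> * nuclear_norm Z * (nuclear_norm Z - rect_diag s \<bullet> Z)"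
    using gap by (simp add: n D_def mult_ac)
  with \<open>S \<in> psd_corner p\<close> show ?thesis by (rule that)
qed

section \<open>The normal cone and its contingent cone\<close>

lemma matrix_diff_ldistrib: "A ** (B - C) = A ** B - A ** C" for A :: "real^'n^'m"
  by (simp add: matrix_matrix_mult_def vec_eq_iff sum_subtractf right_diff_distrib)

lemma matrix_diff_rdistrib: "(A - B) ** C = A ** C - B ** C" for A :: "real^'n^'m"
  by (simp add: matrix_matrix_mult_def vec_eq_iff sum_subtractf left_diff_distrib)

lemma transpose_add: "transpose (A + B) = transpose A + transpose B" for A :: "real^'n^'m"
  by (simp add: transpose_def vec_eq_iff)

lemma symmetric_nth:
  assumes "transpose A = A"
  shows "A $ i $ j = A $ j $ i"
proof -
  have "transpose A $ j $ i = A $ i $ j" by (simp add: transpose_def)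
  then show ?thesis by (simp only: assms)
qed

text \<open>Both sides are compared with the sum of the eigenvalues of \<open>S\<close>.
  Eigenvectors with nonzero eigenvalue live on the first \<open>p\<close> coordinates, where
  \<open>rect_diag s\<close> is the identity, so the right side equals that sum; the left side is at
  most that sum since the eigenvalues are nonnegative.\<close>

lemma psd_corner_nuclear_norm_le:
  fixes S :: "real^('m::{finite,linorder})^('m::{finite,linorder})"
  assumes card: "CARD('m) \<le> CARD('n)" and S: "S \<in> psd_corner p"
    and s: "\<And>k. k < p \<Longrightarrow> s k = 1"
  shows "nuclear_norm (S ** (row_isometry :: real^('n::{finite,linorder})^('m::{finite,linorder}))) \<le>
    rect_diag s \<bullet> (S ** (row_isometry :: real^('n::{finite,linorder})^('m::{finite,linorder})))"
proof -
  let ?E = "row_isometry :: real^('n::{finite,linorder})^('m::{finite,linorder})"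
  have sym: "transpose S = S" and psd: "\<And>x. 0 \<le> x \<bullet> (S *v x)"
    and supp: "\<And>i j. S $ i $ j \<noteq> 0 \<Longrightarrow> pos i < p"
    using S unfolding psd_corner_def by blast+
  obtain u l where ul: "eigenbasis S u l" using symmetric_matrix_eigenbasis[OF sym] by blast
  then have u: "orthonormal_family u" and Su: "\<And>i. S *v u i = l i *\<^sub>R u i"
    by (auto simp: eigenbasis_def)
  have uu: "u i \<bullet> u i = 1" for i using orthonormal_familyD(1)[OF u, of i i] by simp
  have l0: "0 \<le> l i" for i using psd[of "u i"] by (simp add: Su uu)
  have inner: "(S ** ?E) \<bullet> Q =
      (\<Sum>i\<in>UNIV. l i * ((transpose ?E *v u i) \<bullet> (transpose Q *v u i)))" for Q
  proof -
    have "(S ** ?E) \<bullet> Q = (\<Sum>i\<in>UNIV. (S *v u i) \<bullet> (transpose (Q ** transpose ?E) *v u i))"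
      by (subst inner_matrix_mult_right, subst inner_matrix_orthonormal[OF u]) (simp only: sym)
    also have "\<dots> = (\<Sum>i\<in>UNIV. l i * ((transpose ?E *v u i) \<bullet> (transpose Q *v u i)))"
      by (simp only: Su inner_scaleR_left transpose_vector_inner matrix_transpose_mul
          transpose_transpose matrix_vector_mul_assoc)
    finally show ?thesis .
  qed
  have "rect_diag s \<bullet> (S ** ?E) = (\<Sum>i\<in>UNIV. l i)"
    unfolding inner_commute[of "rect_diag s"] inner
  proof (intro sum.cong refl)
    fix i
    have "transpose (rect_diag s :: real^('n::{finite,linorder})^('m::{finite,linorder})) *v u i = transpose ?E *v (rect_diag s *v u i)"
      by (subst rect_diag_factor)
        (simp only: matrix_transpose_mul transpose_rect_diag matrix_vector_mul_assoc)
    then have "(transpose ?E *v u i) \<bullet> (transpose (rect_diag s :: real^('n::{finite,linorder})^('m::{finite,linorder})) *v u i) =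
        u i \<bullet> (rect_diag s *v u i)"
      by (simp only: transpose_vector_inner matrix_vector_mul_assoc row_isometry_transpose[OF card]
          matrix_mul_assoc matrix_mul_lid)
    moreover have "rect_diag s *v u i = u i" if "l i \<noteq> 0"
    proof (subst vec_eq_iff, intro allI)
      fix k
      show "(rect_diag s *v u i) $ k = u i $ k"
      proof (cases "pos k < p")
        case False
        then have "S $ k $ j = 0" for j using supp by blast
        then have "(S *v u i) $ k = 0" by (simp add: matrix_vector_mult_def)
        then have "u i $ k = 0" using that by (simp add: Su)
        then show ?thesis by (simp add: rect_diag_square_mult)
      qed (simp add: rect_diag_square_mult s)
    qed
    ultimately show "l i * ((transpose ?E *v u i) \<bullet> (transpose (rect_diag s :: real^('n::{finite,linorder})^('m::{finite,linorder})) *v u i)) = l i"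
      using uu by (cases "l i = 0") simp_all
  qed
  moreover obtain Q where Q: "Q \<in> spectral_ball" "(S ** ?E) \<bullet> Q = nuclear_norm (S ** ?E)"
    by (rule nuclear_norm_attained)
  moreover have "(S ** ?E) \<bullet> Q \<le> (\<Sum>i\<in>UNIV. l i)"
    unfolding inner
  proof (intro sum_mono)
    fix i
    have "(transpose ?E *v u i) \<bullet> (transpose Q *v u i) \<le> norm (transpose ?E *v u i) * norm (transpose Q *v u i)"
      by (rule norm_cauchy_schwarz)
    also have "\<dots> \<le> 1 * 1"
      using transpose_spectral_ball[OF Q(1)] orthonormal_familyD(2)[OF u]
      by (intro mult_mono) (metis norm_row_isometry[OF card] order_refl mem_spectral_ball norm_ge_zero zero_le_one)+
    finally show "l i * ((transpose ?E *v u i) \<bullet> (transpose Q *v u i)) \<le> l i"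
      using l0[of i] by (simp add: mult_left_le)
  qed
  ultimately show ?thesis by simp
qed

text \<open>The growth estimate is first proved for the image of the corner. Since it provides an
  explicit point of the image, a zero gap makes \<open>Z\<close> equal to that point, which yields
  the inclusion of the normal cone in the image.\<close>

lemma normal_cone_spectral_ball:
  fixes U :: "real^('m::{finite,linorder})^('m::{finite,linorder})" and V :: "real^('n::{finite,linorder})^('n::{finite,linorder})" and Y :: "real^('n::{finite,linorder})^('m::{finite,linorder})"
  assumes card: "CARD('m::{finite,linorder}) \<le> CARD('n::{finite,linorder})"
    and UV: "orthogonal_matrix U" "orthogonal_matrix V"
    and Y: "Y = U ** rect_diag s ** transpose V" "Y \<in> spectral_ball"
    and s: "\<And>k. k < p \<Longrightarrow> s k = 1"
    and s': "\<And>k. p \<le> k \<Longrightarrow> k < CARD('m) \<Longrightarrow> (s k)\<^sup>2 \<le> 1 - \<delta>"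
    and \<delta>: "0 < \<delta>" "\<delta> \<le> 1"
  shows "normal_cone spectral_ball Y =
    (\<lambda>S. U ** (S ** row_isometry) ** transpose V) ` psd_corner p" (is "_ = ?K")
    and "\<exists>K \<in> normal_cone spectral_ball Y. (norm (Z - K))\<^sup>2 \<le>
       10 / \<delta> * nuclear_norm Z * (nuclear_norm Z - Y \<bullet> Z)"
proof -
  have nuc: "nuclear_norm (U ** W ** transpose V) = nuclear_norm W" for W
    using nuclear_norm_orthogonal[of "transpose U" "transpose V" W] UV by simp
  have inner: "Y \<bullet> (U ** W ** transpose V) = rect_diag s \<bullet> W" for W
    by (simp only: Y(1) inner_matrix_conjugate inner_commute[of _ "U ** W ** transpose V"]
        transpose_transpose orthogonal_conjugate_cancel[OF UV] inner_commute[of W])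
  have sub: "?K \<subseteq> normal_cone spectral_ball Y"
  proof
    fix X assume "X \<in> ?K"
    then obtain S where S: "S \<in> psd_corner p" and X: "X = U ** (S ** row_isometry) ** transpose V"
      by blast
    have "nuclear_norm X \<le> Y \<bullet> X"
      unfolding X nuc inner by (rule psd_corner_nuclear_norm_le[OF card S s])
    moreover have "Y \<bullet> X \<le> nuclear_norm X"
      using inner_le_nuclear_norm[OF Y(2), of X] by (simp only: inner_commute)
    ultimately show "X \<in> normal_cone spectral_ball Y"
      by (simp add: mem_normal_cone_spectral_ball[OF Y(2)])
  qed
  have growth: "\<exists>K\<in>?K. (norm (Z - K))\<^sup>2 \<le>
      10 / \<delta> * nuclear_norm Z * (nuclear_norm Z - Y \<bullet> Z)" for Z
  proof -
    define Z' where "Z' = transpose U ** Z ** V"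
    have Z: "Z = U ** Z' ** transpose V"
      unfolding Z'_def by (simp only: orthogonal_conjugate_cancel[OF UV])
    obtain S :: "real^('m::{finite,linorder})^('m::{finite,linorder})" where S: "S \<in> psd_corner p"
      "(norm (Z' - S ** row_isometry))\<^sup>2 \<le>
        10 / \<delta> * nuclear_norm Z' * (nuclear_norm Z' - rect_diag s \<bullet> Z')"
      by (rule nuclear_norm_quadratic_growth[OF card s s' \<delta>])
    have "Z - U ** (S ** row_isometry) ** transpose V
        = U ** (Z' - S ** row_isometry) ** transpose V"
      unfolding Z by (simp only: matrix_diff_ldistrib matrix_diff_rdistrib)
    then have "norm (Z - U ** (S ** row_isometry) ** transpose V) = norm (Z' - S ** row_isometry)"
      by (simp only: norm_orthogonal_conjugate[OF UV])
    moreover have "nuclear_norm Z = nuclear_norm Z'" "Y \<bullet> Z = rect_diag s \<bullet> Z'"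
      unfolding Z nuc inner by (rule refl)+
    ultimately show ?thesis using S by force
  qed
  show "normal_cone spectral_ball Y = ?K"
  proof
    show "normal_cone spectral_ball Y \<subseteq> ?K"
    proof
      fix X assume "X \<in> normal_cone spectral_ball Y"
      then have "nuclear_norm X = Y \<bullet> X" by (simp add: mem_normal_cone_spectral_ball[OF Y(2)])
      then obtain K where "K \<in> ?K" "(norm (X - K))\<^sup>2 \<le> 0" using growth[of X] by auto
      then show "X \<in> ?K" by simp
    qed
  qed (rule sub)
  then show "\<exists>K \<in> normal_cone spectral_ball Y. (norm (Z - K))\<^sup>2 \<le>
       10 / \<delta> * nuclear_norm Z * (nuclear_norm Z - Y \<bullet> Z)"
    using growth by simp
qed

text \<open>The left inverse \<open>L'\<close> pulls tangent sequences back. It also inverts on the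
  other side where required, since every direction \<open>W k\<close> is a multiple of a difference
  of two points in the range of \<open>L\<close>, and the limit inherits this.\<close>

lemma contingent_cone_injective_image:
  assumes L: "bounded_linear L" and L': "bounded_linear L'" and inv: "\<And>x. L' (L x) = x"
  shows "contingent_cone (L ` K) (L x) = L ` contingent_cone K x"
proof
  interpret L: bounded_linear L by (rule L)
  interpret L': bounded_linear L' by (rule L')
  show "L ` contingent_cone K x \<subseteq> contingent_cone (L ` K) (L x)"
  proof
    fix y assume "y \<in> L ` contingent_cone K x"
    then obtain w t W where y: "y = L w" and t: "\<forall>k. t k > 0" "t \<longlonglongrightarrow> 0"
      and W: "W \<longlonglongrightarrow> w" "\<forall>k. x + t k *\<^sub>R W k \<in> K"
      by (auto simp: contingent_cone_def)
    have "L x + t k *\<^sub>R L (W k) \<in> L ` K" for k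
      using W(2) by (metis L.add L.scaleR imageI)
    then show "y \<in> contingent_cone (L ` K) (L x)"
      unfolding contingent_cone_def mem_Collect_eq y
      by (intro exI[of _ t] exI[of _ "\<lambda>k. L (W k)"] conjI allI L.tendsto[OF W(1)] t(2) t(1)[rule_format])
  qed
  show "contingent_cone (L ` K) (L x) \<subseteq> L ` contingent_cone K x"
  proof
    fix y assume "y \<in> contingent_cone (L ` K) (L x)"
    then obtain t W where t: "\<forall>k. t k > 0" "t \<longlonglongrightarrow> 0"
      and W: "W \<longlonglongrightarrow> y" "\<forall>k. L x + t k *\<^sub>R W k \<in> L ` K"
      by (auto simp: contingent_cone_def)
    have *: "L (L' (W k)) = W k" "x + t k *\<^sub>R L' (W k) \<in> K" for k
    proof -
      obtain z where z: "z \<in> K" "L x + t k *\<^sub>R W k = L z" using W(2) by blast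
      have tk: "t k \<noteq> 0" using t(1) by (metis less_irrefl)
      have Wk: "W k = L ((z - x) /\<^sub>R t k)"
        using z(2) tk by (simp add: L.scaleR L.diff flip: z(2))
      then have "L' (W k) = (z - x) /\<^sub>R t k" by (simp add: inv)
      then show "L (L' (W k)) = W k" "x + t k *\<^sub>R L' (W k) \<in> K" using Wk z(1) tk by simp_all
    qed
    have lim: "(\<lambda>k. L' (W k)) \<longlonglongrightarrow> L' y" by (rule L'.tendsto[OF W(1)])
    then have "L' y \<in> contingent_cone K x"
      unfolding contingent_cone_def mem_Collect_eq
      by (intro exI[of _ t] exI[of _ "\<lambda>k. L' (W k)"] conjI allI *(2) lim t(2) t(1)[rule_format])
    moreover have "W \<longlonglongrightarrow> L (L' y)" using L.tendsto[OF lim] by (simp add: *(1))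
    then have "y = L (L' y)" by (rule LIMSEQ_unique[OF W(1)])
    ultimately show "y \<in> L ` contingent_cone K x" by blast
  qed
qed

section \<open>Tangents to the semidefinite corner\<close>

definition supported :: "nat \<Rightarrow> real^('m::{finite,linorder})^('m::{finite,linorder}) \<Rightarrow> bool" where
  "supported p A \<longleftrightarrow> (\<forall>i j. A $ i $ j \<noteq> 0 \<longrightarrow> pos i < p \<and> pos j < p)"

lemma supported_add: "supported p A \<Longrightarrow> supported p B \<Longrightarrow> supported p (A + B)"
  unfolding supported_def by (metis add.right_neutral vector_add_component)

lemma supported_scaleR: "supported p A \<Longrightarrow> supported p (c *\<^sub>R A)"
  by (auto simp: supported_def)

lemma supported_transpose: "supported p A \<Longrightarrow> supported p (transpose A)"
  by (auto simp: supported_def transpose_def)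

lemma supported_mult:
  assumes "supported p A" "supported p B"
  shows "supported p (A ** B)"
  unfolding supported_def
proof (intro allI impI)
  fix i j assume "(A ** B) $ i $ j \<noteq> 0"
  then obtain k where "A $ i $ k * B $ k $ j \<noteq> 0"
    unfolding matrix_matrix_mult_def by (auto elim: sum.not_neutral_contains_not_neutral)
  then show "pos i < p \<and> pos j < p" using assms by (auto simp: supported_def)
qed

lemma psd_corner_iff:
  "S \<in> psd_corner p \<longleftrightarrow> transpose S = S \<and> (\<forall>x. 0 \<le> x \<bullet> (S *v x)) \<and> supported p S"
  by (simp add: psd_corner_def supported_def)

text \<open>A vector vanishing on the first \<open>r\<close> positions lies in the kernel of
  \<open>rect_diag \<sigma>\<close>, so the quadratic form at it sees only the perturbation, which
  forces the sign condition in the limit. No such condition arises on the rest, where the diagonal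
  is positive.\<close>

lemma contingent_cone_psd_corner:
  assumes rp: "r \<le> p" and pos: "\<And>k. k < r \<Longrightarrow> 0 < \<sigma> k"
    and zero: "\<And>k. r \<le> k \<Longrightarrow> k < CARD('m) \<Longrightarrow> \<sigma> k = 0"
  shows "contingent_cone (psd_corner p) (rect_diag \<sigma> :: real^('m::{finite,linorder})^('m::{finite,linorder})) =
    {W. transpose W = W \<and> (\<forall>x. (\<forall>i. pos i < r \<longrightarrow> x $ i = 0) \<longrightarrow> 0 \<le> x \<bullet> (W *v x)) \<and>
        supported p W}" (is "?T = ?R")
proof
  let ?D = "rect_diag \<sigma> :: real^('m::{finite,linorder})^('m::{finite,linorder})"
  have \<sigma>0: "r \<le> pos i \<Longrightarrow> \<sigma> (pos i) = 0" for i :: 'm using zero pos_less by blast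
  have D0: "?D *v x = 0" if "\<forall>i. pos i < r \<longrightarrow> x $ i = 0" for x
    using that \<sigma>0 by (auto simp: vec_eq_iff rect_diag_square_mult) (meson leI)
  show "?T \<subseteq> ?R"
  proof
    fix W assume "W \<in> ?T"
    then obtain t Wk where t: "\<forall>k. t k > 0" and W: "Wk \<longlonglongrightarrow> W"
      and mem: "\<forall>k. ?D + t k *\<^sub>R Wk k \<in> psd_corner p"
      by (auto simp: contingent_cone_def)
    have entry: "(\<lambda>k. Wk k $ i $ j) \<longlonglongrightarrow> W $ i $ j" for i j
      by (intro tendsto_vec_nth W)
    have sym: "Wk k $ i $ j = Wk k $ j $ i" for k i j
    proof -
      have "transpose (?D + t k *\<^sub>R Wk k) = ?D + t k *\<^sub>R Wk k" using mem psd_corner_iff by blast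
      then have "(?D + t k *\<^sub>R Wk k) $ j $ i = (?D + t k *\<^sub>R Wk k) $ i $ j"
        by (rule symmetric_nth)
      moreover have "t k \<noteq> 0" using t by (metis less_irrefl)
      ultimately show ?thesis by (auto simp: rect_diag_def split: if_splits)
    qed
    have "W $ i $ j = W $ j $ i" for i j
      using entry[of j i] unfolding sym[of _ j i] by (rule LIMSEQ_unique[OF entry[of i j]])
    then have "transpose W = W" by (simp add: vec_eq_iff transpose_def)
    moreover have "0 \<le> x \<bullet> (W *v x)" if x: "\<forall>i. pos i < r \<longrightarrow> x $ i = 0" for x
    proof (rule LIMSEQ_le_const)
      have "(\<lambda>k. Wk k *v x) \<longlonglongrightarrow> W *v x"
        unfolding matrix_vector_mult_def by (intro vec_tendstoI) (auto intro!: tendsto_intros entry)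
      then show "(\<lambda>k. x \<bullet> (Wk k *v x)) \<longlonglongrightarrow> x \<bullet> (W *v x)" by (intro tendsto_intros)
      have "0 \<le> x \<bullet> ((?D + t k *\<^sub>R Wk k) *v x)" for k using mem psd_corner_iff by blast
      then have "0 \<le> t k * (x \<bullet> (Wk k *v x))" for k
        by (simp add: matrix_vector_mult_add_rdistrib D0[OF x] flip: scaleR_matrix_vector_assoc)
      then show "\<exists>N. \<forall>k\<ge>N. 0 \<le> x \<bullet> (Wk k *v x)" using t by (metis mult_le_cancel_left_pos mult_zero_right)
    qed
    moreover have "supported p W"
      unfolding supported_def
    proof (intro allI impI, rule ccontr)
      fix i j assume ne: "W $ i $ j \<noteq> 0" and out: "\<not> (pos i < p \<and> pos j < p)"
      have "Wk k $ i $ j = 0" for k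
      proof -
        have "(?D + t k *\<^sub>R Wk k) $ i $ j = 0" using mem out by (auto simp: psd_corner_def)
        moreover have "?D $ i $ j = 0" using out \<sigma>0[of i] rp by (auto simp: rect_diag_def)
        moreover have "t k \<noteq> 0" using t by (metis less_irrefl)
        ultimately show ?thesis by simp
      qed
      then show False using entry[of i j] ne by (simp add: LIMSEQ_const_iff)
    qed
    ultimately show "W \<in> ?R" by blast
  qed
  show "?R \<subseteq> ?T"
  proof
    fix W assume "W \<in> ?R"
    then have sym: "transpose W = W" and psd: "\<And>x. \<forall>i. pos i < r \<longrightarrow> x $ i = 0 \<Longrightarrow> 0 \<le> x \<bullet> (W *v x)"
      and supp: "supported p W" by blast+
    have Wij: "W $ i $ j = W $ j $ i" for i j by (rule symmetric_nth[OF sym])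
    \<comment> \<open>The curve \<open>(1 + t N)\<^sup>T (\<Sigma> + t C) (1 + t N)\<close> is a congruence, hence stays positive
      semidefinite, and its derivative \<open>C + N\<^sup>T \<Sigma> + \<Sigma> N\<close> at \<open>t = 0\<close> is \<open>W\<close>.\<close>
    define C :: "real^('m::{finite,linorder})^('m::{finite,linorder})" where
      "C = (\<chi> i j. if r \<le> pos i \<and> r \<le> pos j then W $ i $ j else 0)"
    \<comment> \<open>Entries with both positions below \<open>r\<close> are produced by both N^T
      Sigma and Sigma N, hence the factor 2; entries of the block B come from Sigma N alone and
      their mirror images from N^T Sigma.\<close>
    define N :: "real^('m::{finite,linorder})^('m::{finite,linorder})" where
      "N = (\<chi> i j. if pos i < r then W $ i $ j / ((if pos j < r then 2 else 1) * \<sigma> (pos i)) else 0)"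
    have suppC: "supported p C" and suppN: "supported p N"
      using supp by (auto simp: supported_def C_def N_def split: if_splits)
    have suppD: "supported p ?D"
      using \<sigma>0 rp by (auto simp: supported_def rect_diag_def split: if_splits) (meson leI order_trans)+
    have "?D ** N = (\<chi> i j. \<sigma> (pos i) * N $ i $ j)"
      by (simp add: vec_eq_iff matrix_matrix_mult_def rect_diag_def if_distrib if_distribR cong: if_cong)
    moreover have "transpose N ** ?D = (\<chi> i j. N $ j $ i * \<sigma> (pos j))"
      by (simp add: vec_eq_iff matrix_matrix_mult_def transpose_def rect_diag_def if_distrib cong: if_cong)
    moreover have "C $ i $ j + N $ j $ i * \<sigma> (pos j) + \<sigma> (pos i) * N $ i $ j = W $ i $ j" for i j
      using Wij[of j i] pos[of "pos i"] pos[of "pos j"] \<sigma>0[of i] \<sigma>0[of j]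
      by (auto simp: C_def N_def)
    ultimately have W: "W = C + transpose N ** ?D + ?D ** N" by (simp add: vec_eq_iff)
    \<comment> \<open>\<open>G\<close> and \<open>G'\<close> are the coefficients of t^2 and t^3 in
      the expanded congruence.\<close>
    define G where "G = transpose N ** C + C ** N + transpose N ** ?D ** N"
    define G' where "G' = transpose N ** C ** N"
    have symC: "transpose C = C" using Wij by (simp add: C_def transpose_def vec_eq_iff)
    have psdC: "0 \<le> x \<bullet> (C *v x)" for x
    proof -
      define y where "y = (\<chi> i. if r \<le> pos i then x $ i else 0)"
      have "x \<bullet> (C *v x) = y \<bullet> (W *v y)"
        unfolding inner_vec_def matrix_vector_mult_def y_def C_def
        by (auto intro!: sum.cong simp: sum_distrib_left)
      also have "\<dots> \<ge> 0" by (rule psd) (simp add: y_def)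
      finally show ?thesis .
    qed
    have psdD: "0 \<le> x \<bullet> (?D *v x)" for x
    proof -
      have "0 \<le> \<sigma> (pos i)" for i :: 'm using pos[of "pos i"] \<sigma>0[of i] by (cases "pos i < r") auto
      moreover have "x \<bullet> (?D *v x) = (\<Sum>i\<in>UNIV. \<sigma> (pos i) * (x $ i)\<^sup>2)"
        by (simp add: inner_vec_def rect_diag_square_mult power2_eq_square mult_ac)
      ultimately show ?thesis by (simp add: sum_nonneg)
    qed
    have mem: "?D + t *\<^sub>R (W + t *\<^sub>R G + t\<^sup>2 *\<^sub>R G') \<in> psd_corner p" if "t > 0" for t
      unfolding psd_corner_iff
    proof (intro conjI allI)
      have "transpose G = G" "transpose G' = G'"
        by (simp_all add: G_def G'_def transpose_add matrix_transpose_mul symC transpose_rect_diag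
            matrix_mul_assoc)
      then show "transpose (?D + t *\<^sub>R (W + t *\<^sub>R G + t\<^sup>2 *\<^sub>R G'))
          = ?D + t *\<^sub>R (W + t *\<^sub>R G + t\<^sup>2 *\<^sub>R G')"
        using sym by (simp add: transpose_add transpose_scalar transpose_rect_diag)
      show "supported p (?D + t *\<^sub>R (W + t *\<^sub>R G + t\<^sup>2 *\<^sub>R G'))"
        unfolding G_def G'_def
        by (intro supported_add supported_scaleR supported_mult supported_transpose suppC suppD suppN supp)
      fix x
      define y where "y = x + t *\<^sub>R (N *v x)"
      have N: "x \<bullet> (z v* N) = (N *v x) \<bullet> z" for z by (metis dot_lmul_matrix inner_commute)
      have "x \<bullet> ((?D + t *\<^sub>R (W + t *\<^sub>R G + t\<^sup>2 *\<^sub>R G')) *v x)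
          = y \<bullet> (?D *v y) + t * (y \<bullet> (C *v y))"
        unfolding W G_def G'_def y_def
        by (simp add: matrix_vector_mult_add_rdistrib matrix_vector_right_distrib
            matrix_vector_mult_scaleR inner_add_left inner_add_right
            N power2_eq_square algebra_simps
            flip: scaleR_matrix_vector_assoc matrix_vector_mul_assoc)
      then show "0 \<le> x \<bullet> ((?D + t *\<^sub>R (W + t *\<^sub>R G + t\<^sup>2 *\<^sub>R G')) *v x)"
        using psdC psdD that by simp
    qed
    define t where "t k = 1 / real (Suc k)" for k
    have t: "\<forall>k. t k > 0" "t \<longlonglongrightarrow> 0"
      unfolding t_def using LIMSEQ_inverse_real_of_nat by (auto simp: inverse_eq_divide)
    have "(\<lambda>k. W + t k *\<^sub>R G + (t k)\<^sup>2 *\<^sub>R G') \<longlonglongrightarrow> W + 0 *\<^sub>R G + 0\<^sup>2 *\<^sub>R G'"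
      by (intro tendsto_intros t)
    then show "W \<in> ?T"
      unfolding contingent_cone_def mem_Collect_eq using t mem
      by (intro exI[of _ t] exI[of _ "\<lambda>k. W + t k *\<^sub>R G + (t k)\<^sup>2 *\<^sub>R G'"]) simp
  qed
qed

section \<open>Tangents in block form\<close>

lemma sum_lessThan_shift:
  fixes g :: "nat \<Rightarrow> real"
  assumes "r \<le> p" "\<And>i. i < r \<Longrightarrow> g i = 0"
  shows "(\<Sum>i<p. g i) = (\<Sum>i<p - r. g (r + i))"
proof -
  have "(\<Sum>i<r + d. g i) = (\<Sum>i<r. g i) + (\<Sum>i<d. g (r + i))" for d
    by (induction d) auto
  from this[of "p - r"] show ?thesis using assms by simp
qed

lemma corner_quadratic_form:
  assumes "p \<le> CARD('m)"
  shows "(\<chi> i. \<xi> (pos i)) \<bullet> ((corner p M :: real^('m::{finite,linorder})^('m::{finite,linorder})) *v (\<chi> i. \<xi> (pos i))) =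
    (\<Sum>i<p. \<Sum>j<p. \<xi> i * M i j * \<xi> j)"
proof -
  let ?f = "\<lambda>a b. if a < p \<and> b < p then \<xi> a * M a b * \<xi> b else 0"
  have "(\<chi> i. \<xi> (pos i)) \<bullet> ((corner p M :: real^('m::{finite,linorder})^('m::{finite,linorder})) *v (\<chi> i. \<xi> (pos i))) =
      (\<Sum>i\<in>(UNIV :: 'm set). \<Sum>j\<in>(UNIV :: 'm set). ?f (pos i) (pos j))"
    unfolding inner_vec_def matrix_vector_mult_def corner_def
    by (intro sum.cong refl) (auto simp: sum_distrib_left intro!: sum.cong)
  also have "\<dots> = (\<Sum>a<CARD('m). \<Sum>b<CARD('m). ?f a b)"
    by (simp only: sum_pos[where f = "\<lambda>b. ?f _ b"] sum_pos[where f = "\<lambda>a. \<Sum>b<CARD('m). ?f a b"])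
  also have "\<dots> = (\<Sum>a<p. \<Sum>b<CARD('m). ?f a b)"
    using assms by (intro sum.mono_neutral_right) auto
  also have "\<dots> = (\<Sum>a<p. \<Sum>b<p. \<xi> a * M a b * \<xi> b)"
  proof (rule sum.cong[OF refl])
    fix a assume "a \<in> {..<p}"
    have "(\<Sum>b<CARD('m). ?f a b) = (\<Sum>b<p. ?f a b)"
      using assms by (intro sum.mono_neutral_right) auto
    then show "(\<Sum>b<CARD('m). ?f a b) = (\<Sum>b<p. \<xi> a * M a b * \<xi> b)"
      using \<open>a \<in> {..<p}\<close> by simp
  qed
  finally show ?thesis .
qed

lemma four_block_quadratic_form:
  assumes "r \<le> p" "\<And>k. k < r \<Longrightarrow> \<xi> k = 0"
  shows "(\<Sum>i<p. \<Sum>j<p. \<xi> i * four_block r A B D C i j * \<xi> j) =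
    (\<Sum>i<p - r. \<Sum>j<p - r. \<xi> (r + i) * C i j * \<xi> (r + j))"
  using assms by (simp add: sum_lessThan_shift[OF assms(1)] four_block_def)

lemma inv_pos [simp]: "inv pos (pos i) = (i :: 'm::{finite,linorder})"
  by (rule inv_f_f) (simp add: inj_def)

lemma pos_inv: "k < CARD('m) \<Longrightarrow> pos (inv pos k :: 'm::{finite,linorder}) = k"
  using pos_ex by (metis inv_pos)

lemma vec_eq_inv_pos: "x = (\<chi> i. x $ (inv pos (pos i)))" for x :: "real^('m::{finite,linorder})"
  by (simp add: vec_eq_iff)

text \<open>Test vectors that vanish on the first \<open>r\<close> positions see only the block
  \<open>C\<close>, so the sign condition says that \<open>C\<close> is semidefinite and leaves
  \<open>A\<close> and \<open>B\<close> free up to symmetry.\<close>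

lemma psd_corner_tangents_eq_blocks:
  assumes rp: "r \<le> p" and p: "p \<le> CARD('m)"
  shows "{W :: real^('m::{finite,linorder})^('m::{finite,linorder}). transpose W = W \<and>
      (\<forall>x. (\<forall>i. pos i < r \<longrightarrow> x $ i = 0) \<longrightarrow> 0 \<le> x \<bullet> (W *v x)) \<and> supported p W} =
    {corner p (four_block r A B (\<lambda>i j. B j i) C) | A B C. sym_block r A \<and> psd_block (p - r) C}"
    (is "?L = ?R")
proof
  show "?L \<subseteq> ?R"
  proof
    fix W assume "W \<in> ?L"
    then have sym: "transpose W = W" and supp: "supported p W"
      and psd: "\<And>x. \<forall>i. pos i < r \<longrightarrow> x $ i = 0 \<Longrightarrow> 0 \<le> x \<bullet> (W *v x)" by blast+
    define M where "M a b = W $ (inv pos a) $ (inv pos b)" for a b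
    have M: "M a b = M b a" for a b unfolding M_def by (rule symmetric_nth[OF sym])
    define B C where "B i j = M i (r + j)" and "C i j = M (r + i) (r + j)" for i j
    have W: "W = corner p (four_block r M B (\<lambda>i j. B j i) C)"
      unfolding vec_eq_iff
    proof (intro allI)
      fix i j :: 'm
      have "W $ i $ j = M (pos i) (pos j)" by (simp add: M_def)
      moreover have "\<not> (pos i < p \<and> pos j < p) \<Longrightarrow> W $ i $ j = 0"
        using supp by (auto simp: supported_def)
      ultimately show "W $ i $ j = corner p (four_block r M B (\<lambda>i j. B j i) C) $ i $ j"
        using M[of "pos i" "pos j"] by (auto simp: corner_def four_block_def B_def C_def)
    qed
    have "0 \<le> (\<Sum>i<p - r. \<Sum>j<p - r. y i * C i j * y j)" for y
    proof -
      \<comment> \<open>Padding \<open>y\<close> with \<open>r\<close> leading zeros makes it an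
        admissible test vector.\<close>
      define \<xi> where "\<xi> k = (if k < r then 0 else y (k - r))" for k
      have "0 \<le> (\<chi> i. \<xi> (pos i)) \<bullet> (W *v (\<chi> i. \<xi> (pos i)))"
        by (rule psd) (simp add: \<xi>_def)
      also have "\<dots> = (\<Sum>i<p - r. \<Sum>j<p - r. \<xi> (r + i) * C i j * \<xi> (r + j))"
        unfolding W corner_quadratic_form[OF p] by (rule four_block_quadratic_form[OF rp]) (simp add: \<xi>_def)
      finally show ?thesis by (simp add: \<xi>_def)
    qed
    then have "psd_block (p - r) C" using M by (simp add: psd_block_def sym_block_def C_def)
    moreover have "sym_block r M" using M by (simp add: sym_block_def)
    ultimately show "W \<in> ?R" using W by blast
  qed
  show "?R \<subseteq> ?L"
  proof
    fix W assume "W \<in> ?R"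
    then obtain A B C where W: "W = corner p (four_block r A B (\<lambda>i j. B j i) C)"
      and A: "sym_block r A" and C: "psd_block (p - r) C" by blast
    have "transpose W = W"
      using A C by (auto simp: W transpose_def vec_eq_iff corner_def four_block_def sym_block_def psd_block_def)
    moreover have "0 \<le> x \<bullet> (W *v x)" if x: "\<forall>i. pos i < r \<longrightarrow> x $ i = 0" for x
    proof -
      define \<xi> where "\<xi> k = x $ (inv pos k)" for k
      have xi: "x = (\<chi> i. \<xi> (pos i))" unfolding \<xi>_def by (rule vec_eq_inv_pos)
      have "\<xi> k = 0" if "k < r" for k
        using x pos_inv[where 'm = 'm, of k] that rp p by (simp add: \<xi>_def)
      then have "x \<bullet> (W *v x) = (\<Sum>i<p - r. \<Sum>j<p - r. \<xi> (r + i) * C i j * \<xi> (r + j))"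
        unfolding W xi corner_quadratic_form[OF p] by (rule four_block_quadratic_form[OF rp])
      then show ?thesis using C by (simp add: psd_block_def)
    qed
    moreover have "supported p W" by (auto simp: W supported_def corner_def split: if_splits)
    ultimately show "W \<in> ?L" by blast
  qed
qed

lemma sym_block_four_block:
  assumes "sym_block r A" "sym_block (p - r) C" "r \<le> p"
  shows "sym_block p (four_block r A B (\<lambda>i j. B j i) C)"
  using assms by (auto simp: sym_block_def four_block_def)

section \<open>Second-order expansions\<close>

text \<open>Justifies the definite description in \<open>gradient\<close>: the representing vector
  is \<open>adjoint f' 1\<close>, and it is unique because the derivative is.\<close>

lemma gderiv_gradient:
  assumes "f differentiable (at x)"
  shows "GDERIV f x :> gradient f x"
proof -
  obtain f' where f': "(f has_derivative f') (at x)" using assms by (auto simp: differentiable_def)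
  have lin: "linear f'" using f' has_derivative_linear by blast
  have "(\<lambda>h. h \<bullet> adjoint f' 1) = f'" using adjoint_works[OF lin, of _ 1] by auto
  then have D: "GDERIV f x :> adjoint f' 1" using f' by (simp add: gderiv_def)
  have "E = adjoint f' 1" if "GDERIV f x :> E" for E
  proof -
    have "(\<lambda>h. h \<bullet> E) = (\<lambda>h. h \<bullet> adjoint f' 1)"
      using has_derivative_unique D that by (auto simp: gderiv_def)
    then show ?thesis by (metis vector_eq_ldot)
  qed
  with D show ?thesis unfolding gradient_def by (rule theI)
qed

lemma gradient_has_derivative_hessian:
  assumes "gradient f differentiable (at x)"
  shows "(gradient f has_derivative (\<lambda>v. hessian f x *v v)) (at x)"
proof -
  have d: "(gradient f has_derivative frechet_derivative (gradient f) (at x)) (at x)"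
    using assms by (simp add: frechet_derivative_works)
  then have "linear (frechet_derivative (gradient f) (at x))" by (rule has_derivative_linear)
  then show ?thesis using d by (simp add: hessian_def matrix_works)
qed

text \<open>The remainder has gradient g(y) - g(x) - H (y - x) at y, which is o(|y - x|) by
  differentiability of \<open>g\<close> at the single point \<open>x\<close>; the mean value
  inequality on a small ball integrates this bound. Symmetry of \<open>H\<close> identifies the
  derivative of the quadratic term.\<close>

lemma peano_second_order:
  fixes f :: "real^'m \<Rightarrow> real"
  assumes S: "open S" "x \<in> S" and f: "\<And>y. y \<in> S \<Longrightarrow> GDERIV f y :> g y"
    and g: "(g has_derivative (\<lambda>v. H *v v)) (at x)" and sym: "transpose H = H" and e: "0 < e"
  shows "\<exists>d>0. \<forall>v. norm v < d \<longrightarrow>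
    \<bar>f (x + v) - f x - g x \<bullet> v - (v \<bullet> (H *v v)) / 2\<bar> \<le> e * (norm v)\<^sup>2"
proof -
  obtain d1 where d1: "d1 > 0" "ball x d1 \<subseteq> S" using S by (meson openE)
  obtain d2 where d2: "d2 > 0"
    "\<And>y. norm (y - x) < d2 \<Longrightarrow> norm (g y - g x - H *v (y - x)) \<le> e * norm (y - x)"
    using g e unfolding has_derivative_at_alt by blast
  define \<phi> where "\<phi> y = f y - f x - g x \<bullet> (y - x) - ((y - x) \<bullet> (H *v (y - x))) / 2" for y
  have Hsym: "a \<bullet> (H *v b) = b \<bullet> (H *v a)" for a b
    using transpose_vector_inner[of H a b] sym by (simp add: inner_commute)
  have "\<bar>\<phi> (x + v)\<bar> \<le> e * (norm v)\<^sup>2" if v: "norm v < min d1 d2" for v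
  proof -
    have "norm (\<phi> (x + v) - \<phi> x) \<le> (e * norm v) * norm (x + v - x)"
    proof (rule differentiable_bound[of "cball x (norm v)" \<phi> "\<lambda>y h. h \<bullet> (g y - g x - H *v (y - x))"])
      fix y assume "y \<in> cball x (norm v)"
      then have y: "norm (y - x) \<le> norm v" by (simp add: dist_norm norm_minus_commute)
      then have "y \<in> S" using v d1(2) by (auto simp: dist_norm norm_minus_commute subset_iff)
      then have "(f has_derivative (\<lambda>h. h \<bullet> g y)) (at y)" using f by (simp add: gderiv_def)
      moreover have "((\<lambda>y. H *v (y - x)) has_derivative (\<lambda>h. H *v h)) (at y)"
        by (rule bounded_linear.has_derivative[OF matrix_vector_mul_bounded_linear])
          (auto intro!: derivative_eq_intros)
      ultimately have "(\<phi> has_derivative (\<lambda>h. h \<bullet> g y - g x \<bullet> h -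
          ((y - x) \<bullet> (H *v h) + h \<bullet> (H *v (y - x))) / 2)) (at y)"
        unfolding \<phi>_def by (auto intro!: derivative_eq_intros)
      moreover have "(\<lambda>h. h \<bullet> g y - g x \<bullet> h - ((y - x) \<bullet> (H *v h) + h \<bullet> (H *v (y - x))) / 2) =
          (\<lambda>h. h \<bullet> (g y - g x - H *v (y - x)))"
        using Hsym[of "y - x"] by (auto simp: inner_diff_right inner_commute[of "g x"])
      ultimately show "(\<phi> has_derivative (\<lambda>h. h \<bullet> (g y - g x - H *v (y - x)))) (at y within cball x (norm v))"
        by (simp add: has_derivative_at_withinI)
      have "norm (g y - g x - H *v (y - x)) \<le> e * norm v"
        using d2(2)[of y] y v e by (smt (verit) mult_left_mono)
      then show "onorm (\<lambda>h. h \<bullet> (g y - g x - H *v (y - x))) \<le> e * norm v"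
        using e
        by (intro onorm_bound)
          (auto intro!: order_trans[OF Cauchy_Schwarz_ineq2] simp: mult.commute mult_left_mono)
    qed (auto simp: dist_norm)
    then show ?thesis by (simp add: \<phi>_def power2_eq_square mult.assoc)
  qed
  then show ?thesis using d1(1) d2(1) by (intro exI[of _ "min d1 d2"]) (auto simp: \<phi>_def)
qed

lemma second_order_quotient_limit:
  fixes f :: "real^'m \<Rightarrow> real"
  assumes S: "open S" "x \<in> S" and f: "\<And>y. y \<in> S \<Longrightarrow> GDERIV f y :> g y"
    and g: "(g has_derivative (\<lambda>v. H *v v)) (at x)" and sym: "transpose H = H"
    and t: "\<forall>k. 0 < t k" "t \<longlonglongrightarrow> 0" and v: "v \<longlonglongrightarrow> w"
  shows "(\<lambda>k. (f (x + t k *\<^sub>R v k) - f x - g x \<bullet> (t k *\<^sub>R v k)) / (t k)\<^sup>2) \<longlonglongrightarrow> (w \<bullet> (H *v w)) / 2"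
proof -
  define \<phi> where "\<phi> v = f (x + v) - f x - g x \<bullet> v - (v \<bullet> (H *v v)) / 2" for v
  have "(\<lambda>k. \<phi> (t k *\<^sub>R v k) / (t k)\<^sup>2) \<longlonglongrightarrow> 0"
  proof (rule tendstoI)
    fix e :: real assume e: "e > 0"
    have "Bseq v" using v by (intro convergent_imp_Bseq) (auto simp: convergent_def)
    then obtain B where B: "B > 0" "\<And>k. norm (v k) \<le> B" by (auto simp: Bseq_def)
    \<comment> \<open>Chosen so that the error, at most \<open>\<epsilon> * B\<^sup>2\<close> after
      division by t^2, equals \<open>e / 2\<close> at worst.\<close>
    define \<epsilon> where "\<epsilon> = e / (2 * B\<^sup>2)"
    have \<epsilon>: "\<epsilon> > 0" using e B by (simp add: \<epsilon>_def)
    obtain d where d: "d > 0" "\<And>v. norm v < d \<Longrightarrow> \<bar>\<phi> v\<bar> \<le> \<epsilon> * (norm v)\<^sup>2"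
      using peano_second_order[OF S f g sym \<epsilon>] unfolding \<phi>_def by blast
    have "(\<lambda>k. t k *\<^sub>R v k) \<longlonglongrightarrow> 0 *\<^sub>R w" by (intro tendsto_intros t v)
    then have "\<forall>\<^sub>F k in sequentially. norm (t k *\<^sub>R v k) < d"
      using d(1) by (auto dest!: tendstoD[of _ _ _ d] simp: dist_norm)
    then show "\<forall>\<^sub>F k in sequentially. dist (\<phi> (t k *\<^sub>R v k) / (t k)\<^sup>2) 0 < e"
    proof eventually_elim
      case (elim k)
      have tk: "t k > 0" using t(1) by blast
      have "\<bar>\<phi> (t k *\<^sub>R v k)\<bar> \<le> \<epsilon> * (norm (t k *\<^sub>R v k))\<^sup>2" by (rule d(2)[OF elim])
      also have "\<dots> = (\<epsilon> * (norm (v k))\<^sup>2) * (t k)\<^sup>2" by (simp add: power_mult_distrib)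
      finally have "\<bar>\<phi> (t k *\<^sub>R v k)\<bar> / (t k)\<^sup>2 \<le> \<epsilon> * (norm (v k))\<^sup>2"
        using tk by (simp add: divide_le_eq)
      also have "\<dots> \<le> \<epsilon> * B\<^sup>2" using B \<epsilon> by (intro mult_left_mono power_mono) auto
      also have "\<dots> < e" using e B by (simp add: \<epsilon>_def)
      finally show ?case using tk by (simp add: dist_norm)
    qed
  qed
  moreover have "(\<lambda>k. H *v v k) \<longlonglongrightarrow> H *v w"
    by (rule bounded_linear.tendsto[OF matrix_vector_mul_bounded_linear v])
  then have "(\<lambda>k. (v k \<bullet> (H *v v k)) / 2) \<longlonglongrightarrow> (w \<bullet> (H *v w)) / 2"
    by (intro tendsto_intros v) auto
  ultimately have "(\<lambda>k. \<phi> (t k *\<^sub>R v k) / (t k)\<^sup>2 + (v k \<bullet> (H *v v k)) / 2) \<longlonglongrightarrow> 0 + (w \<bullet> (H *v w)) / 2"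
    by (rule tendsto_add)
  moreover have "\<phi> (t k *\<^sub>R v k) / (t k)\<^sup>2 + (v k \<bullet> (H *v v k)) / 2 =
      (f (x + t k *\<^sub>R v k) - f x - g x \<bullet> (t k *\<^sub>R v k)) / (t k)\<^sup>2" for k
    using t(1)[rule_format, of k]
    by (simp add: \<phi>_def matrix_vector_mult_scaleR field_simps power2_eq_square)
  ultimately show ?thesis by simp
qed

lemma zero_mem_contingent_cone:
  assumes "x \<in> K"
  shows "0 \<in> contingent_cone K x"
proof -
  have "(\<lambda>k. inverse (real (Suc k))) \<longlonglongrightarrow> 0" by (rule LIMSEQ_inverse_real_of_nat)
  then show ?thesis
    unfolding contingent_cone_def mem_Collect_eq using assms
    by (intro exI[of _ "\<lambda>k. inverse (real (Suc k))"] exI[of _ "\<lambda>_. 0"]) auto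
qed

section \<open>Strong solutions\<close>

text \<open>Here \<open>\<rho>\<close> is the second-order remainder of the smooth part, with
  positive definite limit form \<open>q\<close>, and \<open>n\<close> is the gap, zero on
  \<open>N\<close>. The growth factor \<open>b\<close> may depend on the point, since only its limit
  at \<open>X\<close> enters.\<close>

lemma strong_solution_iff_Ker_contingent_cone:
  fixes \<Phi> :: "'a::euclidean_space \<Rightarrow> 'b::euclidean_space" and \<phi> :: "'a \<Rightarrow> ereal"
  assumes lin: "linear \<Phi>" and \<mu>: "0 < \<mu>"
    and val: "\<And>z. \<phi> z \<noteq> \<infinity> \<Longrightarrow> \<phi> z = ereal (\<alpha> + \<rho> (\<Phi> (z - X)) + \<mu> * n z)"
    and valX: "\<phi> X = ereal \<alpha>"
    and fin: "0 < \<delta>" "\<And>z. norm (z - X) < \<delta> \<Longrightarrow> \<phi> z \<noteq> \<infinity>"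
    and lim: "\<And>t v w. (\<forall>k. 0 < t k) \<Longrightarrow> t \<longlonglongrightarrow> 0 \<Longrightarrow> v \<longlonglongrightarrow> w \<Longrightarrow>
      (\<lambda>k. \<rho> (t k *\<^sub>R v k) / (t k)\<^sup>2) \<longlonglongrightarrow> q w"
    and q: "q 0 = 0" "\<And>w. w \<noteq> 0 \<Longrightarrow> 0 < q w"
    and n: "\<And>z. 0 \<le> n z" "\<And>z. z \<in> N \<Longrightarrow> n z = 0" and XN: "X \<in> N"
    and growth: "\<And>z. \<exists>K\<in>N. (norm (z - K))\<^sup>2 \<le> b z * n z" and b: "isCont b X"
  shows "strong_solution \<phi> X \<longleftrightarrow> Ker \<Phi> \<inter> contingent_cone N X = {0}"
proof
  assume "strong_solution \<phi> X"
  then obtain c \<epsilon> where c: "c > 0" and \<epsilon>: "\<epsilon> > 0"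
    and strong: "\<And>z. norm (z - X) \<le> \<epsilon> \<Longrightarrow> \<phi> z - \<phi> X \<ge> ereal (c * (norm (z - X))\<^sup>2)"
    unfolding strong_solution_def by blast
  have "W = 0" if W: "W \<in> contingent_cone N X" "\<Phi> W = 0" for W
  proof -
    obtain t Wk where t: "\<forall>k. 0 < t k" "t \<longlonglongrightarrow> 0" and Wk: "Wk \<longlonglongrightarrow> W"
      and mem: "\<And>k. X + t k *\<^sub>R Wk k \<in> N"
      using W(1) by (auto simp: contingent_cone_def)
    have "(\<lambda>k. t k *\<^sub>R Wk k) \<longlonglongrightarrow> 0 *\<^sub>R W" by (intro tendsto_intros t Wk)
    then have "\<forall>\<^sub>F k in sequentially. norm (t k *\<^sub>R Wk k) < min \<delta> \<epsilon>"
      using fin(1) \<epsilon> by (auto dest!: tendstoD[of _ _ _ "min \<delta> \<epsilon>"] simp: dist_norm)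
    \<comment> \<open>On \<open>N\<close> the gap vanishes, so along a tangent sequence the
      objective changes only by \<open>\<rho>\<close>; strong growth bounds this from below, while
      it is o(t^2) for a direction in the kernel.\<close>
    then have "\<forall>\<^sub>F k in sequentially. c * (norm (Wk k))\<^sup>2 \<le> \<rho> (t k *\<^sub>R \<Phi> (Wk k)) / (t k)\<^sup>2"
    proof eventually_elim
      case (elim k)
      let ?z = "X + t k *\<^sub>R Wk k"
      have tk: "0 < t k" using t(1) by blast
      have "\<phi> ?z = ereal (\<alpha> + \<rho> (t k *\<^sub>R \<Phi> (Wk k)))"
        using val[OF fin(2)[of ?z]] elim n(2)[OF mem[of k]] by (simp add: linear_cmul[OF lin])
      then have "c * (norm (t k *\<^sub>R Wk k))\<^sup>2 \<le> \<rho> (t k *\<^sub>R \<Phi> (Wk k))"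
        using strong[of ?z] elim valX by simp
      then show ?case using tk by (simp add: power_mult_distrib field_simps)
    qed
    moreover have "(\<lambda>k. \<Phi> (Wk k)) \<longlonglongrightarrow> \<Phi> W"
      using lin Wk by (simp add: linear_conv_bounded_linear bounded_linear.tendsto)
    then have "(\<lambda>k. \<rho> (t k *\<^sub>R \<Phi> (Wk k)) / (t k)\<^sup>2) \<longlonglongrightarrow> 0"
      using lim[OF t] W(2) q(1) by metis
    moreover have "(\<lambda>k. c * (norm (Wk k))\<^sup>2) \<longlonglongrightarrow> c * (norm W)\<^sup>2" by (intro tendsto_intros Wk)
    ultimately have "c * (norm W)\<^sup>2 \<le> 0" by (intro tendsto_le[OF sequentially_bot])
    then show "W = 0" using c by (simp add: mult_le_0_iff)
  qed
  moreover have "0 \<in> contingent_cone N X" by (rule zero_mem_contingent_cone[OF XN])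
  ultimately show "Ker \<Phi> \<inter> contingent_cone N X = {0}"
    using linear_0[OF lin] by (auto simp: Ker_def)
next
  assume ker: "Ker \<Phi> \<inter> contingent_cone N X = {0}"
  show "strong_solution \<phi> X"
  proof (rule ccontr)
    assume not: "\<not> strong_solution \<phi> X"
    \<comment> \<open>One parameter \<open>e\<close> serves as both the radius and the growth
      constant. The violating points have finite value, since an infinite one would satisfy the
      growth inequality.\<close>
    have "\<exists>z. norm (z - X) \<le> e \<and> \<not> \<phi> z - \<phi> X \<ge> ereal (e * (norm (z - X))\<^sup>2)" if "e > 0" for e
      using not that valX unfolding strong_solution_def by fastforce
    then have "\<forall>k. \<exists>z. norm (z - X) \<le> inverse (real (Suc k)) \<and>
        \<not> \<phi> z - \<phi> X \<ge> ereal (inverse (real (Suc k)) * (norm (z - X))\<^sup>2)"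
      by simp
    from choice[OF this] obtain Z where Z: "\<And>k. norm (Z k - X) \<le> inverse (real (Suc k))"
      "\<And>k. \<not> \<phi> (Z k) - \<phi> X \<ge> ereal (inverse (real (Suc k)) * (norm (Z k - X))\<^sup>2)" by blast
    define s where "s k = norm (Z k - X)" for k
    define \<epsilon> where "\<epsilon> k = inverse (real (Suc k))" for k
    have \<epsilon>0: "\<epsilon> \<longlonglongrightarrow> 0" unfolding \<epsilon>_def by (rule LIMSEQ_inverse_real_of_nat)
    have small: "\<rho> (\<Phi> (Z k - X)) + \<mu> * n (Z k) < \<epsilon> k * (s k)\<^sup>2" for k
    proof -
      have "\<phi> (Z k) \<noteq> \<infinity>" using Z(2)[of k] valX by auto
      from val[OF this] show ?thesis using Z(2)[of k] valX by (simp add: \<epsilon>_def s_def)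
    qed
    have s: "0 < s k" for k
    proof (rule ccontr)
      assume "\<not> 0 < s k"
      then have "Z k = X" by (simp add: s_def)
      then show False using Z(2)[of k] valX by simp
    qed
    have "\<forall>k. (Z k - X) /\<^sub>R s k \<in> sphere 0 1" using s by (simp add: s_def)
    from seq_compactE[OF compact_imp_seq_compact[OF compact_sphere] this] obtain W \<sigma> where W: "W \<in> sphere 0 1" and \<sigma>: "strict_mono (\<sigma> :: nat \<Rightarrow> nat)"
      and lim\<sigma>: "((\<lambda>k. (Z k - X) /\<^sub>R s k) \<circ> \<sigma>) \<longlonglongrightarrow> W" by blast
    define t where "t = s \<circ> \<sigma>"
    define Wk where "Wk k = (Z (\<sigma> k) - X) /\<^sub>R t k" for k
    have t: "\<forall>k. 0 < t k" using s by (simp add: t_def)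
    have ZW: "Z (\<sigma> k) - X = t k *\<^sub>R Wk k" for k
      using t[rule_format, of k] by (simp add: Wk_def)
    have "Wk = (\<lambda>k. (Z k - X) /\<^sub>R s k) \<circ> \<sigma>" by (simp add: fun_eq_iff Wk_def t_def)
    then have Wk: "Wk \<longlonglongrightarrow> W" using lim\<sigma> by simp
    have \<epsilon>\<sigma>: "(\<lambda>k. \<epsilon> (\<sigma> k)) \<longlonglongrightarrow> 0" using LIMSEQ_subseq_LIMSEQ[OF \<epsilon>0 \<sigma>] by (simp add: o_def)
    have t0: "t \<longlonglongrightarrow> 0"
    proof (rule tendsto_sandwich[OF _ _ tendsto_const \<epsilon>\<sigma>])
      show "\<forall>\<^sub>F k in sequentially. 0 \<le> t k" using t by (simp add: less_imp_le)
      show "\<forall>\<^sub>F k in sequentially. t k \<le> \<epsilon> (\<sigma> k)" using Z(1) by (simp add: t_def s_def \<epsilon>_def)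
    qed
    define R where "R k = \<rho> (t k *\<^sub>R \<Phi> (Wk k)) / (t k)\<^sup>2" for k
    define g where "g k = n (Z (\<sigma> k)) / (t k)\<^sup>2" for k
    have small': "R k + \<mu> * g k \<le> \<epsilon> (\<sigma> k)" for k
    proof -
      have "\<rho> (t k *\<^sub>R \<Phi> (Wk k)) + \<mu> * n (Z (\<sigma> k)) \<le> \<epsilon> (\<sigma> k) * (t k)\<^sup>2"
        using small[of "\<sigma> k"] by (simp add: ZW linear_cmul[OF lin] t_def)
      then show ?thesis using t[rule_format, of k] by (simp add: R_def g_def field_simps)
    qed
    have g0: "0 \<le> g k" for k using n(1) by (simp add: g_def)
    have \<Phi>Wk: "(\<lambda>k. \<Phi> (Wk k)) \<longlonglongrightarrow> \<Phi> W"
      using lin Wk by (simp add: linear_conv_bounded_linear bounded_linear.tendsto)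
    have R: "R \<longlonglongrightarrow> q (\<Phi> W)" unfolding R_def using lim[OF t t0 \<Phi>Wk] .
    \<comment> \<open>As the gap is nonnegative, the remainder quotient alone stays below a null
      sequence; its limit \<open>q (\<Phi> W)\<close> is therefore at most 0, and positive
      definiteness gives \<open>\<Phi> W = 0\<close>.\<close>
    have "R k \<le> \<epsilon> (\<sigma> k)" for k
      using small'[of k] mult_nonneg_nonneg[OF less_imp_le[OF \<mu>] g0[of k]] by simp
    then have "q (\<Phi> W) \<le> 0" using R \<epsilon>\<sigma> by (intro LIMSEQ_le) auto
    then have \<Phi>W: "\<Phi> W = 0" using q(2) by force
    \<comment> \<open>Now that the remainder quotient tends to 0, nothing is left to offset the gap
      quotient, which must tend to 0 as well.\<close>
    have gl: "g \<longlonglongrightarrow> 0"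
    proof (rule tendsto_sandwich[OF _ _ tendsto_const])
      show "\<forall>\<^sub>F k in sequentially. 0 \<le> g k" using g0 by simp
      have "g k \<le> (\<epsilon> (\<sigma> k) - R k) / \<mu>" for k using small'[of k] \<mu> by (simp add: field_simps)
      then show "\<forall>\<^sub>F k in sequentially. g k \<le> (\<epsilon> (\<sigma> k) - R k) / \<mu>" by simp
      have "(\<lambda>k. (\<epsilon> (\<sigma> k) - R k) / \<mu>) \<longlonglongrightarrow> (0 - q (\<Phi> W)) / \<mu>"
        using \<mu> by (intro tendsto_intros \<epsilon>\<sigma> R) auto
      then show "(\<lambda>k. (\<epsilon> (\<sigma> k) - R k) / \<mu>) \<longlonglongrightarrow> 0" by (simp add: \<Phi>W q(1))
    qed
    have "\<forall>k. \<exists>K. K \<in> N \<and> (norm (Z (\<sigma> k) - K))\<^sup>2 \<le> b (Z (\<sigma> k)) * n (Z (\<sigma> k))"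
      using growth by blast
    from choice[OF this] obtain K where K: "\<And>k. K k \<in> N"
      "\<And>k. (norm (Z (\<sigma> k) - K k))\<^sup>2 \<le> b (Z (\<sigma> k)) * n (Z (\<sigma> k))" by blast
    \<comment> \<open>The scaled correction that moves the violating point onto \<open>N\<close>.
      Its square is at most \<open>b\<close> times the gap quotient, so subtracting it keeps the
      limit direction \<open>W\<close> and makes the sequence feasible.\<close>
    define E where "E k = (Z (\<sigma> k) - K k) /\<^sub>R t k" for k
    have "(\<lambda>k. t k *\<^sub>R Wk k + X) \<longlonglongrightarrow> 0 *\<^sub>R W + X" by (intro tendsto_intros t0 Wk)
    then have "(\<lambda>k. Z (\<sigma> k)) \<longlonglongrightarrow> X" by (simp flip: ZW)
    then have bl: "(\<lambda>k. b (Z (\<sigma> k))) \<longlonglongrightarrow> b X" by (rule isCont_tendsto_compose[OF b])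
    have "(\<lambda>k. (norm (E k))\<^sup>2) \<longlonglongrightarrow> 0"
    proof (rule tendsto_sandwich[OF _ _ tendsto_const])
      have "(norm (E k))\<^sup>2 \<le> b (Z (\<sigma> k)) * g k" for k
      proof -
        have "norm (E k) = norm (Z (\<sigma> k) - K k) / t k"
          using t[rule_format, of k] by (simp add: E_def divide_inverse mult.commute)
        then have "(norm (E k))\<^sup>2 = (norm (Z (\<sigma> k) - K k))\<^sup>2 / (t k)\<^sup>2"
          by (simp add: power_divide)
        also have "\<dots> \<le> b (Z (\<sigma> k)) * n (Z (\<sigma> k)) / (t k)\<^sup>2"
          by (rule divide_right_mono[OF K(2)]) simp
        finally show ?thesis by (simp add: g_def)
      qed
      then show "\<forall>\<^sub>F k in sequentially. (norm (E k))\<^sup>2 \<le> b (Z (\<sigma> k)) * g k" by simp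
      show "(\<lambda>k. b (Z (\<sigma> k)) * g k) \<longlonglongrightarrow> 0" using tendsto_mult[OF bl gl] by simp
    qed simp
    then have "(\<lambda>k. sqrt ((norm (E k))\<^sup>2)) \<longlonglongrightarrow> sqrt 0" by (rule tendsto_real_sqrt)
    then have "E \<longlonglongrightarrow> 0" by (simp add: tendsto_norm_zero_iff)
    then have "(\<lambda>k. Wk k - E k) \<longlonglongrightarrow> W - 0" by (intro tendsto_intros Wk)
    moreover have "X + t k *\<^sub>R (Wk k - E k) \<in> N" for k
    proof -
      have "t k *\<^sub>R E k = Z (\<sigma> k) - K k" using t[rule_format, of k] by (simp add: E_def)
      then show ?thesis using K(1)[of k] by (simp add: scaleR_diff_right flip: ZW)
    qed
    ultimately have "W \<in> contingent_cone N X"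
      unfolding contingent_cone_def mem_Collect_eq using t t0
      by (intro exI[of _ t] exI[of _ "\<lambda>k. Wk k - E k"]) simp
    then have "W = 0" using ker \<Phi>W by (auto simp: Ker_def)
    then show False using W by simp
  qed
qed

section \<open>Continuity of the nuclear norm; singular values and rank\<close>

lemma nuclear_norm_convex: "convex_on UNIV (nuclear_norm :: real^'n^'m \<Rightarrow> real)"
proof (rule convex_onI)
  fix t :: real and X Z :: "real^'n^'m"
  assume "0 < t" "t < 1"
  then show "nuclear_norm ((1 - t) *\<^sub>R X + t *\<^sub>R Z) \<le> (1 - t) * nuclear_norm X + t * nuclear_norm Z"
    using nuclear_norm_add_le[of "(1 - t) *\<^sub>R X" "t *\<^sub>R Z"]
      nuclear_norm_scaleR_le[of "1 - t" X] nuclear_norm_scaleR_le[of t Z] by simp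
qed simp

lemma isCont_nuclear_norm: "isCont (nuclear_norm :: real^'n^'m \<Rightarrow> real) X"
proof -
  have "continuous_on UNIV (nuclear_norm :: real^'n^'m \<Rightarrow> real)"
    by (intro convex_on_continuous open_UNIV nuclear_norm_convex)
  then show ?thesis by (simp add: continuous_on_eq_continuous_at)
qed

text \<open>Turns counts into thresholds: as singular values are nonincreasing, the indices with
  value 1 (for \<open>Y\<close> in the ball) and those with nonzero value are initial segments, of
  lengths \<open>p\<close> and \<open>r\<close>.\<close>

lemma lessThan_card_if_down_closed:
  fixes A :: "nat set"
  assumes "finite A" "\<And>j k. k \<in> A \<Longrightarrow> j \<le> k \<Longrightarrow> j \<in> A"
  shows "A = {..<card A}"
proof (cases "A = {}")
  case False
  then have "Max A \<in> A" using assms(1) by simp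
  then have "A = {..Max A}" using assms(2)[OF \<open>Max A \<in> A\<close>] Max_ge[OF assms(1)] by blast
  then have "A = {..<Suc (Max A)}" by (simp only: lessThan_Suc_atMost)
  then show ?thesis by (metis card_lessThan)
qed simp

lemma sing_val_le_1:
  fixes Y :: "real^'n^'m"
  assumes "Y \<in> spectral_ball" "k < CARD('m)"
  shows "sing_val Y k \<le> 1"
proof -
  obtain u l where ul: "eigenbasis (Y ** transpose Y) u l"
    using gram_eigenbasis_exists by blast
  have "sqrt (l i) \<le> 1" for i
  proof -
    have "l i = (norm (transpose Y *v u i))\<^sup>2"
      unfolding power2_norm_eq_inner gram_eigenbasis(1)[OF ul] by simp
    moreover have "norm (transpose Y *v u i) \<le> norm (u i)"
      using transpose_spectral_ball[OF assms(1)] unfolding mem_spectral_ball by blast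
    moreover have "norm (u i) = 1"
      using ul orthonormal_familyD(2) by (auto simp: eigenbasis_def)
    ultimately show ?thesis by (simp add: power_le_one)
  qed
  then show ?thesis using sing_val_mem[OF ul assms(2)] by auto
qed

lemma sing_val_eq_1_iff:
  fixes Y :: "real^'n^'m"
  assumes "Y \<in> spectral_ball" "k < CARD('m)"
  shows "sing_val Y k = 1 \<longleftrightarrow> k < num_unit_sing_vals Y"
proof -
  let ?A = "{k. k < CARD('m) \<and> sing_val Y k = 1}"
  have "?A = {..<card ?A}"
  proof (rule lessThan_card_if_down_closed)
    fix j k assume "k \<in> ?A" "j \<le> k"
    then show "j \<in> ?A"
      using sing_val_antimono[of j k Y] sing_val_le_1[OF assms(1), of j] by auto
  qed simp
  then show ?thesis using assms(2) unfolding num_unit_sing_vals_def by blast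
qed

lemma num_unit_sing_vals_le: "num_unit_sing_vals (Y :: real^'n^'m) \<le> CARD('m)"
proof -
  have "card {k. k < CARD('m) \<and> sing_val Y k = 1} \<le> card {..<CARD('m)}"
    by (intro card_mono) auto
  then show ?thesis by (simp add: num_unit_sing_vals_def)
qed

lemma rank_rect_diag:
  assumes card: "CARD('m) \<le> CARD('n)"
  shows "rank (rect_diag \<sigma> :: real^('n::{finite,linorder})^('m::{finite,linorder})) =
    card {k. k < CARD('m) \<and> \<sigma> k \<noteq> 0}"
proof -
  let ?D = "rect_diag \<sigma> :: real^('m::{finite,linorder})^('m::{finite,linorder})" and ?E = "row_isometry :: real^('n::{finite,linorder})^('m::{finite,linorder})"
  have "?D = ?D ** ?E ** transpose ?E"
    by (simp add: row_isometry_transpose[OF card] flip: matrix_mul_assoc)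
  then have "rank ?D \<le> rank (?D ** ?E)" by (metis rank_mul_le_left)
  then have "rank (?D ** ?E) = rank ?D" using rank_mul_le_left[of ?D ?E] by simp
  moreover have "range ((*v) ?D) = {x. \<forall>i. i \<notin> {i. \<sigma> (pos i) \<noteq> 0} \<longrightarrow> x $ i = 0}"
  proof
    show "{x. \<forall>i. i \<notin> {i. \<sigma> (pos i) \<noteq> 0} \<longrightarrow> x $ i = 0} \<subseteq> range ((*v) ?D)"
    proof
      fix x :: "real^('m::{finite,linorder})" assume x: "x \<in> {x. \<forall>i. i \<notin> {i. \<sigma> (pos i) \<noteq> 0} \<longrightarrow> x $ i = 0}"
      have "x = ?D *v (\<chi> i. x $ i / \<sigma> (pos i))"
        using x by (auto simp: vec_eq_iff rect_diag_square_mult)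
      then show "x \<in> range ((*v) ?D)" by blast
    qed
  qed (auto simp: rect_diag_square_mult)
  then have "rank ?D = card {i :: 'm. \<sigma> (pos i) \<noteq> 0}"
    using dim_substandard_cart[where 'a = real and d = "{i :: 'm. \<sigma> (pos i) \<noteq> 0}"]
    by (simp add: rank_dim_range flip: dim_vec_eq)
  ultimately show ?thesis
    using card_pos_Collect[where 'n = 'm, of "\<lambda>k. \<sigma> k \<noteq> 0"] by (simp flip: rect_diag_factor)
qed

lemma rank_orthogonal_conjugate:
  fixes P :: "real^'m^'m" and Q :: "real^'n^'n" and X :: "real^'n^'m"
  assumes "orthogonal_matrix P" "orthogonal_matrix Q"
  shows "rank (P ** X ** transpose Q) = rank X"
proof (rule antisym)
  have le: "rank (A ** X ** B) \<le> rank X" for A :: "real^'m^'m" and X :: "real^'n^'m" and B :: "real^'n^'n"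
    by (meson order_trans rank_mul_le_left rank_mul_le_right)
  show "rank (P ** X ** transpose Q) \<le> rank X" by (rule le)
  show "rank X \<le> rank (P ** X ** transpose Q)"
    using le[of "transpose P" "P ** X ** transpose Q" Q]
    by (simp only: orthogonal_conjugate_cancel[OF assms])
qed

lemma sing_val_eq_0_iff:
  fixes X :: "real^('n::{finite,linorder})^('m::{finite,linorder})"
  assumes card: "CARD('m) \<le> CARD('n)" and UV: "(U, V) \<in> svd_pairs X" and k: "k < CARD('m)"
  shows "sing_val X k \<noteq> 0 \<longleftrightarrow> k < rank X"
proof -
  let ?A = "{k. k < CARD('m) \<and> sing_val X k \<noteq> 0}"
  have o: "orthogonal_matrix U" "orthogonal_matrix V"
    and X: "X = U ** rect_diag (sing_val X) ** transpose V"
    using UV by (auto simp: svd_pairs_def)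
  have "rank X = card ?A"
    by (subst X) (simp only: rank_orthogonal_conjugate[OF o] rank_rect_diag[OF card])
  moreover have "?A = {..<card ?A}"
  proof (rule lessThan_card_if_down_closed)
    fix j k assume "k \<in> ?A" "j \<le> k"
    then show "j \<in> ?A"
      using sing_val_antimono[of j k X] sing_val_nonneg[of k X] by auto
  qed simp
  ultimately show ?thesis using k by auto
qed

lemma bounded_linear_matrix_conjugate:
  fixes A :: "real^'k^'m" and B :: "real^'n^'l"
  shows "bounded_linear (\<lambda>S. A ** S ** B)"
proof -
  have "linear (\<lambda>S. A ** S ** B)"
  proof (rule linearI)
    show "A ** (S + T) ** B = A ** S ** B + A ** T ** B" for S T
      by (simp add: matrix_matrix_mult_def vec_eq_iff sum.distrib algebra_simps)
    show "A ** (c *\<^sub>R S) ** B = c *\<^sub>R (A ** S ** B)" for c S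
      by (simp add: matrix_matrix_mult_def vec_eq_iff sum_distrib_left mult_ac)
  qed
  then show ?thesis by (rule linear_conv_bounded_linear[THEN iffD1])
qed

lemma gap_below_one:
  fixes s :: "nat \<Rightarrow> real"
  assumes "\<And>k. p \<le> k \<Longrightarrow> k < m \<Longrightarrow> 0 \<le> s k \<and> s k < 1"
  obtains \<delta> where "0 < \<delta>" "\<delta> \<le> 1" "\<And>k. p \<le> k \<Longrightarrow> k < m \<Longrightarrow> (s k)\<^sup>2 \<le> 1 - \<delta>"
proof -
  \<comment> \<open>The inserted 1 keeps the set nonempty when no index lies beyond
    \<open>p\<close>, and enforces \<open>\<delta> \<le> 1\<close>.\<close>
  define F where "F = insert 1 ((\<lambda>k. 1 - (s k)\<^sup>2) ` {p..<m})"
  have F: "finite F" "F \<noteq> {}" by (simp_all add: F_def)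
  have "(s k)\<^sup>2 < 1" if "p \<le> k" "k < m" for k
    using assms[OF that] by (simp add: abs_square_less_1)
  then have "0 < x" if "x \<in> F" for x using that by (auto simp: F_def)
  then have "0 < Min F" using F by simp
  moreover have "Min F \<le> 1" using F by (intro Min_le) (auto simp: F_def)
  moreover have "(s k)\<^sup>2 \<le> 1 - Min F" if "p \<le> k" "k < m" for k
  proof -
    have "Min F \<le> 1 - (s k)\<^sup>2" using F that by (intro Min_le) (auto simp: F_def)
    then show ?thesis by simp
  qed
  ultimately show ?thesis by (rule that)
qed

text \<open>The common decomposition lets a single linear map \<open>L\<close> send the semidefinite
  corner onto the normal cone and the square diagonal matrix of singular values of \<open>X\<close>
  to \<open>X\<close>, so tangents can be computed upstairs.\<close>

lemma contingent_cone_normal_cone_spectral_ball: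
  fixes X Y :: "real^('n::{finite,linorder})^('m::{finite,linorder})"
  assumes card: "CARD('m) \<le> CARD('n)"
    and Y: "Y \<in> subdifferential nuclear_norm X"
    and UV: "(U, V) \<in> svd_pairs X \<inter> svd_pairs Y"
  defines "r \<equiv> rank X" and "p \<equiv> num_unit_sing_vals Y" and "N \<equiv> normal_cone spectral_ball Y"
  shows "contingent_cone N X =
      {U ** corner p (four_block r A B (\<lambda>i j. B j i) C) ** transpose V | A B C.
         sym_block r A \<and> psd_block (p - r) C}" (is ?cone)
    and "r \<le> p"
    and "\<exists>c. \<forall>Z. \<exists>K\<in>N. (norm (Z - K))\<^sup>2 \<le> c * nuclear_norm Z * (nuclear_norm Z - Y \<bullet> Z)"
proof -
  have o: "orthogonal_matrix U" "orthogonal_matrix V"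
    and XUV: "X = U ** rect_diag (sing_val X) ** transpose V"
    and YUV: "Y = U ** rect_diag (sing_val Y) ** transpose V"
    and svd: "(U, V) \<in> svd_pairs X"
    using UV by (auto simp: svd_pairs_def)
  note ball = subdifferential_nuclear_norm(1)[OF Y]
  have p: "p \<le> CARD('m)" unfolding p_def by (rule num_unit_sing_vals_le)
  have s1: "sing_val Y k = 1" if "k < p" for k
    using sing_val_eq_1_iff[OF ball, of k] that p by (simp add: p_def)
  have "0 \<le> sing_val Y k \<and> sing_val Y k < 1" if "p \<le> k" "k < CARD('m)" for k
    using sing_val_eq_1_iff[OF ball that(2)] sing_val_le_1[OF ball that(2)]
      sing_val_nonneg[OF that(2), of Y] that(1) by (auto simp: p_def less_le)
  then obtain \<delta> where \<delta>: "0 < \<delta>" "\<delta> \<le> 1"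
    "\<And>k. p \<le> k \<Longrightarrow> k < CARD('m) \<Longrightarrow> (sing_val Y k)\<^sup>2 \<le> 1 - \<delta>"
    using gap_below_one[of p "CARD('m)" "sing_val Y"] by metis
  let ?E = "row_isometry :: real^('n::{finite,linorder})^('m::{finite,linorder})"
  define L where "L S = U ** (S ** ?E) ** transpose V" for S :: "real^('m::{finite,linorder})^('m::{finite,linorder})"
  define L' where "L' Z = transpose U ** Z ** (V ** transpose ?E)" for Z :: "real^('n::{finite,linorder})^('m::{finite,linorder})"
  have inv: "L' (L S) = S" for S
  proof -
    have "L' (L S) = transpose U ** (U ** (S ** ?E) ** transpose V) ** V ** transpose ?E"
      by (simp only: L_def L'_def matrix_mul_assoc)
    also have "\<dots> = S"
      unfolding orthogonal_conjugate_cancel[OF o]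
      by (simp add: row_isometry_transpose[OF card] flip: matrix_mul_assoc)
    finally show ?thesis .
  qed
  have L: "bounded_linear L"
    using bounded_linear_matrix_conjugate[of U "?E ** transpose V"]
    unfolding L_def by (simp add: matrix_mul_assoc)
  have L': "bounded_linear L'" unfolding L'_def by (rule bounded_linear_matrix_conjugate)
  have N: "N = L ` psd_corner p"
    unfolding N_def L_def by (rule normal_cone_spectral_ball(1)[OF card o YUV ball s1 \<delta>(3) \<delta>(1,2)])
  have growth: "\<exists>K\<in>N. (norm (Z - K))\<^sup>2 \<le> 10 / \<delta> * nuclear_norm Z * (nuclear_norm Z - Y \<bullet> Z)" for Z
    unfolding N_def
    by (rule normal_cone_spectral_ball(2)[OF card o YUV ball s1 \<delta>(3) \<delta>(1,2)])
  then show "\<exists>c. \<forall>Z. \<exists>K\<in>N. (norm (Z - K))\<^sup>2 \<le> c * nuclear_norm Z * (nuclear_norm Z - Y \<bullet> Z)"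
    by blast
  have LX: "X = L (rect_diag (sing_val X))"
    by (subst XUV) (simp only: L_def flip: rect_diag_factor)
  have "X \<in> N"
    unfolding N_def mem_normal_cone_spectral_ball[OF ball]
    by (simp only: subdifferential_nuclear_norm(2)[OF Y])
  then obtain S where S: "S \<in> psd_corner p" "X = L S" unfolding N by blast
  \<comment> \<open>\<open>X\<close> has a preimage in the corner because it lies in the normal
    cone; injectivity of \<open>L\<close> identifies this preimage with the diagonal matrix.\<close>
  then have "L' (L (rect_diag (sing_val X))) = L' (L S)" using LX by simp
  then have D: "rect_diag (sing_val X) \<in> (psd_corner p :: (real^('m::{finite,linorder})^('m::{finite,linorder})) set)" using S(1) by (simp add: inv)
  note sv0 = sing_val_eq_0_iff[OF card svd]
  \<comment> \<open>If \<open>p < r\<close>, the diagonal entry at position \<open>p\<close> would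
    be a nonzero singular value outside the corner (positions start at 0).\<close>
  show rp: "r \<le> p"
  proof (rule ccontr)
    assume "\<not> r \<le> p"
    moreover have "r \<le> CARD('m)" unfolding r_def using rank_bound[of X] by simp
    ultimately have p': "p < r" "p < CARD('m)" by auto
    then obtain i :: 'm where i: "pos i = p" using pos_ex by blast
    have "rect_diag (sing_val X) $ i $ i \<noteq> 0"
      using sv0[of p] p' i by (simp add: rect_diag_def r_def)
    then show False using D i by (auto simp: psd_corner_def)
  qed
  have \<sigma>: "0 < sing_val X k" if "k < r" for k
  proof -
    have "k < CARD('m)" using that rp p by simp
    then show ?thesis using sv0[of k] sing_val_nonneg[of k X] that by (simp add: r_def)
  qed
  have \<sigma>0: "sing_val X k = 0" if "r \<le> k" "k < CARD('m)" for k
    using sv0[of k] that by (simp add: r_def)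
  have "contingent_cone N X = L ` contingent_cone (psd_corner p) (rect_diag (sing_val X))"
    unfolding N by (subst LX) (rule contingent_cone_injective_image[OF L L' inv])
  also have "\<dots> = L ` {corner p (four_block r A B (\<lambda>i j. B j i) C) | A B C.
      sym_block r A \<and> psd_block (p - r) C}"
    by (subst contingent_cone_psd_corner[OF rp \<sigma> \<sigma>0]) (simp_all only: psd_corner_tangents_eq_blocks[OF rp p])
  also have "\<dots> = {U ** corner p (four_block r A B (\<lambda>i j. B j i) C) ** transpose V | A B C.
         sym_block r A \<and> psd_block (p - r) C}"
  proof -
    have "U ** corner p M ** transpose V = L (corner p M)" for M
      unfolding L_def by (simp only: corner_factor[OF p, symmetric])
    then show ?thesis by (simp only:) blast
  qed
  finally show ?cone .
qed

text \<open>Along the segment from \<open>X\<close> to \<open>Z\<close> convexity of the nuclear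
  norm bounds the gap term by t times its value at \<open>Z\<close>. Dividing by t removes the
  remainder in the limit, because its quotient by t^2 converges.\<close>

lemma minimizer_subdifferential:
  fixes X Y :: "real^'n^'m" and \<rho> :: "'b::real_normed_vector \<Rightarrow> real"
  assumes lin: "linear \<Phi>" and \<mu>: "0 < \<mu>"
    and min: "\<And>Z. norm (Z - X) < \<delta> \<Longrightarrow>
      0 \<le> \<rho> (\<Phi> (Z - X)) + \<mu> * (nuclear_norm Z - nuclear_norm X - Y \<bullet> (Z - X))"
    and \<delta>: "0 < \<delta>"
    and lim: "\<And>t v w. (\<forall>k. 0 < t k) \<Longrightarrow> t \<longlonglongrightarrow> 0 \<Longrightarrow> v \<longlonglongrightarrow> w \<Longrightarrow>
      (\<lambda>k. \<rho> (t k *\<^sub>R v k) / (t k)\<^sup>2) \<longlonglongrightarrow> q w"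
  shows "Y \<in> subdifferential nuclear_norm X"
  unfolding subdifferential_def mem_Collect_eq
proof
  fix Z
  define W where "W = Z - X"
  define t where "t k = inverse (real (Suc k))" for k
  have t: "\<forall>k. 0 < t k" "t \<longlonglongrightarrow> 0" "t k \<le> 1" for k
    unfolding t_def using LIMSEQ_inverse_real_of_nat by (auto simp: inverse_le_1_iff)
  define D where "D = \<mu> * (nuclear_norm Z - nuclear_norm X - Y \<bullet> W)"
  have "(\<lambda>k. \<rho> (t k *\<^sub>R \<Phi> W) / (t k)\<^sup>2) \<longlonglongrightarrow> q (\<Phi> W)" by (intro lim t tendsto_const)
  then have "(\<lambda>k. t k * (\<rho> (t k *\<^sub>R \<Phi> W) / (t k)\<^sup>2) + D) \<longlonglongrightarrow> 0 * q (\<Phi> W) + D"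
    by (intro tendsto_intros t)
  moreover have "(\<lambda>k. t k *\<^sub>R W) \<longlonglongrightarrow> 0 *\<^sub>R W" by (intro tendsto_intros t)
  then have "\<forall>\<^sub>F k in sequentially. norm (t k *\<^sub>R W) < \<delta>"
    using \<delta> by (auto dest!: tendstoD[of _ _ _ \<delta>] simp: dist_norm)
  then have "\<forall>\<^sub>F k in sequentially. 0 \<le> t k * (\<rho> (t k *\<^sub>R \<Phi> W) / (t k)\<^sup>2) + D"
  proof eventually_elim
    case (elim k)
    have tk: "0 < t k" "t k \<le> 1" using t(1,3) by auto
    let ?Z = "X + t k *\<^sub>R W"
    have "?Z = (1 - t k) *\<^sub>R X + t k *\<^sub>R Z" by (simp add: W_def algebra_simps)
    then have "nuclear_norm ?Z \<le> (1 - t k) * nuclear_norm X + t k * nuclear_norm Z"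
      using convex_onD[OF nuclear_norm_convex, of "t k" X Z] tk by simp
    then have "nuclear_norm ?Z - nuclear_norm X - Y \<bullet> (?Z - X) \<le>
        t k * (nuclear_norm Z - nuclear_norm X - Y \<bullet> W)"
      by (simp add: algebra_simps)
    from mult_left_mono[OF this less_imp_le[OF \<mu>]]
    have "\<mu> * (nuclear_norm ?Z - nuclear_norm X - Y \<bullet> (?Z - X)) \<le> t k * D"
      by (simp only: D_def mult.left_commute)
    moreover have "0 \<le> \<rho> (t k *\<^sub>R \<Phi> W) + \<mu> * (nuclear_norm ?Z - nuclear_norm X - Y \<bullet> (?Z - X))"
      using min[of ?Z] elim by (simp add: linear_cmul[OF lin])
    ultimately have "0 \<le> (\<rho> (t k *\<^sub>R \<Phi> W) + t k * D) / t k" using tk by simp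
    also have "\<dots> = t k * (\<rho> (t k *\<^sub>R \<Phi> W) / (t k)\<^sup>2) + D"
      using tk by (simp add: field_simps power2_eq_square)
    finally show ?case .
  qed
  ultimately have "0 \<le> 0 * q (\<Phi> W) + D" by (intro tendsto_lowerbound) auto
  then show "nuclear_norm X + Y \<bullet> (Z - X) \<le> nuclear_norm Z"
    using \<mu> by (simp add: D_def W_def zero_le_mult_iff)
qed

theorem corollary4p2:
  fixes \<Phi> :: "real^('n2::{finite,linorder})^('n1::{finite,linorder}) \<Rightarrow> real^'m"
    and h :: "real^'m \<Rightarrow> ereal"
    and \<mu> :: real
    and X Y :: "real^('n2::{finite,linorder})^('n1::{finite,linorder})"
    and U :: "real^('n1::{finite,linorder})^('n1::{finite,linorder})"
    and V :: "real^('n2::{finite,linorder})^('n2::{finite,linorder})"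
    and r p :: nat
  assumes "CARD('n1) \<le> CARD('n2)"
    and "linear \<Phi>"
    and "\<mu> > 0"
    and "proper_convex h"
    and "C2_on (interior (edom h)) (\<lambda>y. real_of_ereal (h y))"
    and "\<And>Z. \<Phi> Z \<in> interior (edom h) \<Longrightarrow>
           positive_definite (hessian (\<lambda>y. real_of_ereal (h y)) (\<Phi> Z))"
    and "\<Phi> X \<in> interior (edom h)"
    and "\<And>Z. nuclear_objective h \<Phi> \<mu> X \<le> nuclear_objective h \<Phi> \<mu> Z"
    and "Y = - (1 / \<mu>) *\<^sub>R adjoint \<Phi> (gradient (\<lambda>y. real_of_ereal (h y)) (\<Phi> X))"
    and "r = rank X"
    and "p = num_unit_sing_vals Y"
    and "(U, V) \<in> svd_pairs X \<inter> svd_pairs Y"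
  shows "Y \<in> subdifferential nuclear_norm X
     \<and> contingent_cone (normal_cone spectral_ball Y) X =
           {U ** corner p (four_block r A B (\<lambda>i j. B j i) C) ** transpose V | A B C.
              sym_block r A \<and> psd_block (p - r) C}
     \<and> (strong_solution (nuclear_objective h \<Phi> \<mu>) X \<longleftrightarrow>
           Ker \<Phi> \<inter> contingent_cone (normal_cone spectral_ball Y) X = {0})
     \<and> (Ker \<Phi> \<inter> {U ** corner p S ** transpose V | S. sym_block p S} = {0} \<longrightarrow>
           strong_solution (nuclear_objective h \<Phi> \<mu>) X)"
proof -
  note lin = assms(2) and \<mu> = assms(3)
  let ?I = "interior (edom h)"
  define f where "f y = real_of_ereal (h y)" for y
  define H where "H = hessian f (\<Phi> X)"
  define \<rho> where "\<rho> v = f (\<Phi> X + v) - f (\<Phi> X) - gradient f (\<Phi> X) \<bullet> v" for v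
  define \<alpha> where "\<alpha> = f (\<Phi> X) + \<mu> * nuclear_norm X"
  let ?obj = "nuclear_objective h \<Phi> \<mu>"
  have C2: "\<And>y. y \<in> ?I \<Longrightarrow> f differentiable (at y)" "gradient f differentiable (at (\<Phi> X))"
    and H: "transpose H = H" "\<And>v. v \<noteq> 0 \<Longrightarrow> 0 < v \<bullet> (H *v v)"
    using assms(5-7) by (auto simp: C2_on_def positive_definite_def H_def f_def[abs_def])
  have lim: "(\<lambda>k. \<rho> (t k *\<^sub>R v k) / (t k)\<^sup>2) \<longlonglongrightarrow> (w \<bullet> (H *v w)) / 2"
    if "\<forall>k. 0 < t k" "t \<longlonglongrightarrow> 0" "v \<longlonglongrightarrow> w" for t v w
    unfolding \<rho>_def
    by (rule second_order_quotient_limit[OF open_interior assms(7) gderiv_gradient[OF C2(1)] _ H(1) that])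
      (use gradient_has_derivative_hessian[OF C2(2)] in \<open>simp_all add: H_def\<close>)
  \<comment> \<open>The choice of \<open>Y\<close> makes the linear part of the smooth term cancel
    against that of \<open>\<mu>\<close> times the gap.\<close>
  have YZ: "\<mu> * (Y \<bullet> Z) = - (gradient f (\<Phi> X) \<bullet> \<Phi> Z)" for Z
    using \<mu> adjoint_works[OF lin, of Z "gradient f (\<Phi> X)"]
    unfolding assms(9) f_def[abs_def] by (simp add: inner_commute)
  \<comment> \<open>Properness excludes the value minus infinity, so the real-valued
    \<open>f\<close> represents \<open>h\<close> wherever \<open>h\<close> is finite.\<close>
  have hf: "h y = ereal (f y)" if "h y \<noteq> \<infinity>" for y
  proof -
    have "h y \<noteq> - \<infinity>" using assms(4) by (simp add: proper_convex_def)
    then show ?thesis using that by (cases "h y") (auto simp: f_def)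
  qed
  have val: "?obj Z = ereal (\<alpha> + \<rho> (\<Phi> (Z - X)) +
      \<mu> * (nuclear_norm Z - nuclear_norm X - Y \<bullet> (Z - X)))" if "?obj Z \<noteq> \<infinity>" for Z
  proof -
    have "h (\<Phi> Z) \<noteq> \<infinity>" using that by (auto simp: nuclear_objective_def)
    then have "?obj Z = ereal (f (\<Phi> Z) + \<mu> * nuclear_norm Z)"
      by (simp add: nuclear_objective_def hf)
    also have "f (\<Phi> Z) + \<mu> * nuclear_norm Z =
        \<alpha> + \<rho> (\<Phi> (Z - X)) + \<mu> * (nuclear_norm Z - nuclear_norm X - Y \<bullet> (Z - X))"
      using YZ[of "Z - X"] by (simp add: \<alpha>_def \<rho>_def linear_diff[OF lin] right_diff_distrib)
    finally show ?thesis .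
  qed
  obtain e where e: "e > 0" "ball (\<Phi> X) e \<subseteq> edom h"
    using assms(7) by (auto simp: mem_interior)
  have "isCont \<Phi> X" using lin by (simp add: linear_continuous_at linear_conv_bounded_linear)
  then obtain \<delta> where \<delta>: "\<delta> > 0" "\<And>Z. dist Z X < \<delta> \<Longrightarrow> dist (\<Phi> Z) (\<Phi> X) < e"
    using e(1) unfolding continuous_at_eps_delta by blast
  have fin: "?obj Z \<noteq> \<infinity>" if "norm (Z - X) < \<delta>" for Z
  proof -
    have "\<Phi> Z \<in> edom h"
      using e(2) \<delta>(2)[of Z] that by (auto simp: dist_norm norm_minus_commute subset_iff)
    then show ?thesis by (simp add: nuclear_objective_def edom_def)
  qed
  have \<rho>0: "\<rho> 0 = 0" by (simp add: \<rho>_def)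
  have valX: "?obj X = ereal \<alpha>" using val[OF fin[of X]] \<delta>(1) by (simp add: linear_0[OF lin] \<rho>0)
  have sub: "Y \<in> subdifferential nuclear_norm X"
  proof (rule minimizer_subdifferential[OF lin \<mu> _ \<delta>(1) lim])
    fix Z assume "norm (Z - X) < \<delta>"
    then show "0 \<le> \<rho> (\<Phi> (Z - X)) + \<mu> * (nuclear_norm Z - nuclear_norm X - Y \<bullet> (Z - X))"
      using assms(8)[of Z] val[OF fin] valX by simp
  qed
  note cg = contingent_cone_normal_cone_spectral_ball[OF assms(1) sub assms(12), folded assms(10,11)]
  note ball = subdifferential_nuclear_norm(1)[OF sub] and XY = subdifferential_nuclear_norm(2)[OF sub]
  let ?N = "normal_cone spectral_ball Y"
  \<comment> \<open>Since \<open>Y \<bullet> X = nuclear_norm X\<close>, the linearisation error at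
    \<open>X\<close> is the distance from equality in the duality, so it does not depend on
    \<open>X\<close>.\<close>
  have gap: "nuclear_norm Z - nuclear_norm X - Y \<bullet> (Z - X) = nuclear_norm Z - Y \<bullet> Z" for Z
    by (simp add: inner_diff_right XY)
  obtain c where c: "\<And>Z. \<exists>K\<in>?N. (norm (Z - K))\<^sup>2 \<le> c * nuclear_norm Z * (nuclear_norm Z - Y \<bullet> Z)"
    using cg(3) by blast
  have iff: "strong_solution ?obj X \<longleftrightarrow> Ker \<Phi> \<inter> contingent_cone ?N X = {0}"
  proof (rule strong_solution_iff_Ker_contingent_cone[where \<phi> = ?obj and X = X
        and \<alpha> = \<alpha> and \<rho> = \<rho> and N = ?N
        and n = "\<lambda>Z. nuclear_norm Z - Y \<bullet> Z" and q = "\<lambda>w. (w \<bullet> (H *v w)) / 2"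
        and b = "\<lambda>Z. c * nuclear_norm Z", OF lin \<mu> _ valX \<delta>(1) fin lim])
    show "?obj Z = ereal (\<alpha> + \<rho> (\<Phi> (Z - X)) + \<mu> * (nuclear_norm Z - Y \<bullet> Z))"
      if "?obj Z \<noteq> \<infinity>" for Z
      using val[OF that] unfolding gap .
    show "0 < (w \<bullet> (H *v w)) / 2" if "w \<noteq> 0" for w using H(2)[OF that] by simp
    show "0 \<le> nuclear_norm Z - Y \<bullet> Z" for Z
      using inner_le_nuclear_norm[OF ball, of Z] by (simp add: inner_commute)
    show "nuclear_norm Z - Y \<bullet> Z = 0" if "Z \<in> ?N" for Z
      using that by (simp add: mem_normal_cone_spectral_ball[OF ball])
    show "X \<in> ?N" by (simp add: mem_normal_cone_spectral_ball[OF ball] XY)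
    show "\<exists>K\<in>?N. (norm (Z - K))\<^sup>2 \<le> c * nuclear_norm Z * (nuclear_norm Z - Y \<bullet> Z)" for Z
      by (rule c)
    show "isCont (\<lambda>Z. c * nuclear_norm Z) X" by (intro continuous_intros isCont_nuclear_norm)
  qed simp_all
  \<comment> \<open>Forgetting that \<open>C\<close> is semidefinite enlarges the tangent cone to
    all symmetric corners, and 0 is always tangent; a trivial intersection for the larger set is
    therefore trivial for the cone.\<close>
  have "contingent_cone ?N X \<subseteq> {U ** corner p S ** transpose V | S. sym_block p S}"
    unfolding cg(1) using sym_block_four_block[OF _ _ cg(2)] by (auto simp: psd_block_def)
  moreover have "0 \<in> Ker \<Phi> \<inter> contingent_cone ?N X"
    using zero_mem_contingent_cone[of X ?N] linear_0[OF lin]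
    by (simp add: mem_normal_cone_spectral_ball[OF ball] XY Ker_def)
  ultimately have "Ker \<Phi> \<inter> {U ** corner p S ** transpose V | S. sym_block p S} = {0} \<Longrightarrow>
      Ker \<Phi> \<inter> contingent_cone ?N X = {0}"
    by blast
  then show ?thesis using sub cg(1) iff by blast
qed

end
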